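(* Let $K$ be a perfect field of characteristic $p > 0$, let $G$ be a finite simple graph on the vertex set $[n] = \{1, \ldots, n\}$ with edge set $E(G)$, let $S = K[x_1, \ldots, x_n, y_1, \ldots, y_n]$ be the polynomial ring in $2n$ variables over $K$, and let $J_G \subset S$ be the binomial edge ideal of $G$. If $G$ is weakly closed, then the quotient ring $S/J_G$ is $F$-pure.
   Context: All graphs are finite and simple (no loops, no multiple edges). Binomial edge ideal: $J_G$ is the ideal of $S$ generated by the binomials $x_i y_j - x_j y_i$ for all $\{i,j\} \in E(G)$ with $i < j$. Weakly closed: a graph $G$ with $n$ vertices is weakly closed if there exists a labeling of its vertices by $1, \ldots, n$ (a bijection between the vertex set and $[n]$) such that, identifying vertices with their labels, for all integers $1 \le i < j < k \le n$, if $\{i,k\} \in E(G)$ then $\{i,j\} \in E(G)$ or $\{j,k\} \in E(G)$. $F$-pure: let $R$ be a reduced Noetherian ring of characteristic $p > 0$ that is $F$-finite, meaning that $R^{1/p}$ is a finitely generated $R$-module. Then $R$ is $F$-pure if the Frobenius map $R \to R$, $x \mapsto x^p$, is pure; equivalently, the natural inclusion $R \hookrightarrow R^{1/p}$ is a pure homomorphism of $R$-modules, i.e. it remains injective after tensoring over $R$ with any $R$-module. The ring $S/J_G$ is known to be reduced. *)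

theory Defs
  imports
    "HOL-Algebra.Free_Abelian_Groups"
    "HOL-Algebra.QuotRing"
    "HOL-Algebra.Module"
    "HOL-Computational_Algebra.Primes"
begin

section \<open>Tensor products and pure homomorphisms\<close>

definition module_hom ::
    "('a, 'x) ring_scheme \<Rightarrow> ('a, 'b) module \<Rightarrow> ('a, 'c) module \<Rightarrow> ('b \<Rightarrow> 'c) set" where
  "module_hom R A B =
    {f \<in> carrier A \<rightarrow> carrier B.
      (\<forall>x\<in>carrier A. \<forall>y\<in>carrier A. f (x \<oplus>\<^bsub>A\<^esub> y) = f x \<oplus>\<^bsub>B\<^esub> f y) \<and>
      (\<forall>r\<in>carrier R. \<forall>x\<in>carrier A. f (r \<odot>\<^bsub>A\<^esub> x) = r \<odot>\<^bsub>B\<^esub> f x)}"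

abbreviation tensor_gens :: "('a, 'b) module \<Rightarrow> ('a, 'm) module \<Rightarrow> ('b \<times> 'm \<Rightarrow>\<^sub>0 int) monoid" where
  "tensor_gens A M \<equiv> free_Abelian_group (carrier A \<times> carrier M)"

text \<open>The subgroup of the free abelian group on \<open>A \<times> M\<close> generated by the relations that
  make the class of \<open>(a, m)\<close> biadditive and \<open>R\<close>-balanced.\<close>

definition tensor_rels ::
    "('a, 'x) ring_scheme \<Rightarrow> ('a, 'b) module \<Rightarrow> ('a, 'm) module \<Rightarrow> ('b \<times> 'm \<Rightarrow>\<^sub>0 int) set" where
  "tensor_rels R A M = generate (tensor_gens A M)
    ({frag_of (a \<oplus>\<^bsub>A\<^esub> a', m) - frag_of (a, m) - frag_of (a', m) | a a' m.
        a \<in> carrier A \<and> a' \<in> carrier A \<and> m \<in> carrier M} \<union>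
     {frag_of (a, m \<oplus>\<^bsub>M\<^esub> m') - frag_of (a, m) - frag_of (a, m') | a m m'.
        a \<in> carrier A \<and> m \<in> carrier M \<and> m' \<in> carrier M} \<union>
     {frag_of (r \<odot>\<^bsub>A\<^esub> a, m) - frag_of (a, r \<odot>\<^bsub>M\<^esub> m) | r a m.
        r \<in> carrier R \<and> a \<in> carrier A \<and> m \<in> carrier M})"

text \<open>Only the abelian group underlying the tensor product is recorded; its module structure
  plays no role for injectivity of induced maps.\<close>

definition tensor_product ::
    "('a, 'x) ring_scheme \<Rightarrow> ('a, 'b) module \<Rightarrow> ('a, 'm) module \<Rightarrow> ('b \<times> 'm \<Rightarrow>\<^sub>0 int) set monoid" where
  "tensor_product R A M = tensor_gens A M Mod tensor_rels R A M"

text \<open>The map \<open>A \<otimes> M \<rightarrow> B \<otimes> M\<close> induced by \<open>f : A \<rightarrow> B\<close>, i.e.\ \<open>a \<otimes> m \<mapsto> f a \<otimes> m\<close>.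
  For a module homomorphism \<open>f\<close> all members of the union coincide.\<close>

definition tensor_map ::
    "('a, 'x) ring_scheme \<Rightarrow> ('a, 'b) module \<Rightarrow> ('a, 'c) module \<Rightarrow> ('a, 'm) module \<Rightarrow> ('b \<Rightarrow> 'c)
      \<Rightarrow> ('b \<times> 'm \<Rightarrow>\<^sub>0 int) set \<Rightarrow> ('c \<times> 'm \<Rightarrow>\<^sub>0 int) set" where
  "tensor_map R A B M f X =
    (\<Union>z\<in>X. tensor_rels R B M #>\<^bsub>tensor_gens B M\<^esub> frag_extend (\<lambda>(a, m). frag_of (f a, m)) z)"

text \<open>A quantifier inside a formula ranges over modules with elements in one fixed type, so that
  type is a parameter. A statement about \<open>TYPE('m)\<close> with \<open>'m\<close> a type variable occurring
  nowhere else covers test modules over every type.\<close>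

definition pure_hom ::
    "'m itself \<Rightarrow> ('a, 'x) ring_scheme \<Rightarrow> ('a, 'b) module \<Rightarrow> ('a, 'c) module \<Rightarrow> ('b \<Rightarrow> 'c) \<Rightarrow> bool" where
  "pure_hom _ R A B f \<longleftrightarrow> f \<in> module_hom R A B \<and>
    (\<forall>M :: ('a, 'm) module. module R M \<longrightarrow>
      inj_on (tensor_map R A B M f) (carrier (tensor_product R A M)))"


section \<open>F-purity\<close>

definition self_module :: "('a, 'x) ring_scheme \<Rightarrow> ('a, 'a) module" where
  "self_module R =
    \<lparr>carrier = carrier R, monoid.mult = monoid.mult R, one = \<one>\<^bsub>R\<^esub>, zero = \<zero>\<^bsub>R\<^esub>, add = add R, smult = monoid.mult R\<rparr>"

text \<open>The target of Frobenius: \<open>R\<close> as a module over itself by restriction of scalars along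
  \<open>r \<mapsto> r\<^sup>p\<close>. For reduced \<open>R\<close> this is \<open>R\<^sup>1\<^sup>/\<^sup>p\<close>, up to the isomorphism \<open>x\<^sup>1\<^sup>/\<^sup>p \<mapsto> x\<close>.\<close>

definition frobenius_module :: "nat \<Rightarrow> ('a, 'x) ring_scheme \<Rightarrow> ('a, 'a) module" where
  "frobenius_module p R =
    \<lparr>carrier = carrier R, monoid.mult = monoid.mult R, one = \<one>\<^bsub>R\<^esub>, zero = \<zero>\<^bsub>R\<^esub>, add = add R,
     smult = (\<lambda>r x. (r [^]\<^bsub>R\<^esub> p) \<otimes>\<^bsub>R\<^esub> x)\<rparr>"

text \<open>The second line says that \<open>R\<close> has prime characteristic \<open>p\<close>. The finiteness and reducedness
  conditions under which F-purity is usually discussed are not part of the predicate.\<close>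

definition F_pure :: "'m itself \<Rightarrow> nat \<Rightarrow> ('a, 'x) ring_scheme \<Rightarrow> bool" where
  "F_pure T p R \<longleftrightarrow> cring R \<and>
    prime p \<and> \<one>\<^bsub>R\<^esub> \<noteq> \<zero>\<^bsub>R\<^esub> \<and> [p] \<cdot>\<^bsub>R\<^esub> \<one>\<^bsub>R\<^esub> = \<zero>\<^bsub>R\<^esub> \<and>
    pure_hom T R (self_module R) (frobenius_module p R) (\<lambda>x. x [^]\<^bsub>R\<^esub> p)"

definition perfect_field :: "'k::field itself \<Rightarrow> bool" where
  "perfect_field _ \<longleftrightarrow> CHAR('k) = 0 \<or> surj (\<lambda>x :: 'k. x ^ CHAR('k))"


section \<open>Binomial edge ideals and weakly closed graphs\<close>

datatype xy_var = VarX nat | VarY nat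

text \<open>Polynomials are finitely supported maps from monomials (exponent vectors) to coefficients.\<close>

type_synonym 'k xy_poly = "(xy_var \<Rightarrow>\<^sub>0 nat) \<Rightarrow>\<^sub>0 'k"

definition xy_vars :: "nat \<Rightarrow> xy_var set" where
  "xy_vars n = VarX ` {1..n} \<union> VarY ` {1..n}"

definition xy_ring :: "nat \<Rightarrow> 'k::field xy_poly ring" where
  "xy_ring n =
    \<lparr>carrier = {f. \<forall>m\<in>Poly_Mapping.keys f. Poly_Mapping.keys m \<subseteq> xy_vars n},
     monoid.mult = (*), one = 1, zero = 0, add = (+)\<rparr>"

definition var :: "xy_var \<Rightarrow> 'k::field xy_poly" where
  "var v = Poly_Mapping.single (Poly_Mapping.single v 1) 1"

definition simple_graph :: "nat \<Rightarrow> nat set set \<Rightarrow> bool" where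
  "simple_graph n E \<longleftrightarrow> E \<subseteq> {{i, j} | i j. i \<in> {1..n} \<and> j \<in> {1..n} \<and> i \<noteq> j}"

definition binomial_edge_ideal :: "nat \<Rightarrow> nat set set \<Rightarrow> 'k::field xy_poly set" where
  "binomial_edge_ideal n E = Idl\<^bsub>xy_ring n\<^esub>
    {var (VarX i) * var (VarY j) - var (VarX j) * var (VarY i) | i j. {i, j} \<in> E \<and> i < j}"

text \<open>\<open>l\<close> is the labelling, and \<open>(`) l ` E\<close> is the edge set after each vertex has been replaced
  by its label.\<close>

definition weakly_closed :: "nat \<Rightarrow> nat set set \<Rightarrow> bool" where
  "weakly_closed n E \<longleftrightarrow> (\<exists>l. bij_betw l {1..n} {1..n} \<and>
    (\<forall>i j k. 1 \<le> i \<and> i < j \<and> j < k \<and> k \<le> n \<longrightarrow>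
      {i, k} \<in> (`) l ` E \<longrightarrow> {i, j} \<in> (`) l ` E \<or> {j, k} \<in> (`) l ` E))"

end

theory Submission
  imports Defs
begin

text \<open>
  Frobenius is pure as soon as it has a linear retraction. On \<open>S / J\<close> such a retraction comes from an
  additive map \<open>\<phi>\<close> on \<open>S\<close> with \<open>\<phi> (r\<^sup>p g) = r \<phi> g\<close>, \<open>\<phi> 1 = 1\<close> and \<open>\<phi> J \<subseteq> J\<close>
  (\<open>F_pure_quotient_if_compatible_splitting\<close>), so the point is to find \<open>\<phi>\<close>.

  List the vertices as \<open>u 1, \<dots>, u n\<close> in the order of a weakly closed labelling, write
  \<open>[a, b] = x\<^sub>a y\<^sub>b - x\<^sub>b y\<^sub>a\<close>, and call \<open>x\<^sub>a, y\<^sub>a\<close> the column of \<open>a\<close>. Let \<open>F\<close> be the product of \<open>y\<close> at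
  \<open>u 1\<close>, of the minors \<open>[u j, u (j + 1)]\<close> for \<open>0 < j < n\<close>, and of \<open>x\<close> at \<open>u n\<close>. Put
  \<open>\<phi> g = Tr (F\<^sup>p\<^sup>-\<^sup>1 g)\<close>, where \<open>Tr\<close> keeps the monomials all of whose exponents are congruent to
  \<open>p - 1\<close> modulo \<open>p\<close>, rescales the exponents and takes \<open>p\<close>-th roots of the coefficients. In the
  code \<open>F\<close>, \<open>Tr\<close> and \<open>\<phi>\<close> are \<open>multiplier\<close>, \<open>tr\<close> and \<open>splitting\<close>. For a
  suitable weight the leading monomial of \<open>F\<close> is the product of all variables, and \<open>F\<close> has degree
  2 in each column; together these give \<open>\<phi> 1 = 1\<close> (\<open>splitting_1\<close>).

  For \<open>\<phi> J \<subseteq> J\<close> take an edge \<open>{u i, u k}\<close> with \<open>i < k\<close> and let \<open>h = \<phi> (a [u i, u k])\<close>. Two facts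
  hold for every pair \<open>i < k\<close>, whether or not it is an edge. First, \<open>h\<close> lies in the prime ideal
  generated by all minors on \<open>W = {u i, \<dots>, u k}\<close> (\<open>splitting_minor_in_toric_ideal\<close>): this is clear if
  \<open>k = i + 1\<close>, because then \<open>[u i, u k]\<close> divides \<open>F\<close> and \<open>\<phi> (a [u i, u k])\<close> is a multiple of
  \<open>[u i, u k]\<close>, and it propagates to larger \<open>k\<close> by the relation
  \<open>x\<^sub>c [a, b] = x\<^sub>a [c, b] - x\<^sub>b [c, a]\<close> and cancellation of variables. Second, every monomial of \<open>h\<close> has
  positive degree in the columns of \<open>u i\<close> and \<open>u k\<close> (\<open>splitting_minor_col_deg\<close>).

  Weak closedness says that every other vertex of \<open>W\<close> is adjacent to \<open>u i\<close> or to \<open>u k\<close>. Then any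
  minor on \<open>W\<close>, multiplied by a monomial that involves both columns, is already in \<open>J\<close>
  (\<open>monomial_mult_minor\<close>), and so is every element with the two properties above
  (\<open>toric_ideal_subset\<close>).
\<close>

section \<open>Purity of maps with a retraction\<close>

text \<open>Closure is enough for functoriality of the tensor product, and it is immediate for the target of
  Frobenius, whereas distributivity of its scalar action amounts to additivity of Frobenius.\<close>

definition op_closed :: "('a, 'x) ring_scheme \<Rightarrow> ('a, 'b) module \<Rightarrow> bool" where
  "op_closed R A \<longleftrightarrow>
    (\<forall>x\<in>carrier A. \<forall>y\<in>carrier A. x \<oplus>\<^bsub>A\<^esub> y \<in> carrier A) \<and>
    (\<forall>r\<in>carrier R. \<forall>x\<in>carrier A. r \<odot>\<^bsub>A\<^esub> x \<in> carrier A)"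

lemma module_op_closed: "module R M \<Longrightarrow> op_closed R M"
  unfolding op_closed_def
  by (meson abelian_group.axioms(1) abelian_monoid.a_closed module.axioms(2) module.smult_closed)

abbreviation pair_map :: "('b \<Rightarrow> 'c) \<Rightarrow> ('b \<times> 'm \<Rightarrow>\<^sub>0 int) \<Rightarrow> ('c \<times> 'm \<Rightarrow>\<^sub>0 int)" where
  "pair_map f \<equiv> frag_extend (\<lambda>(a, m). frag_of (f a, m))"

abbreviation basic_tensor_rels ::
    "('a, 'x) ring_scheme \<Rightarrow> ('a, 'b) module \<Rightarrow> ('a, 'm) module \<Rightarrow> ('b \<times> 'm \<Rightarrow>\<^sub>0 int) set" where
  "basic_tensor_rels R A M \<equiv>
    {frag_of (a \<oplus>\<^bsub>A\<^esub> a', m) - frag_of (a, m) - frag_of (a', m) | a a' m.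
        a \<in> carrier A \<and> a' \<in> carrier A \<and> m \<in> carrier M} \<union>
     {frag_of (a, m \<oplus>\<^bsub>M\<^esub> m') - frag_of (a, m) - frag_of (a, m') | a m m'.
        a \<in> carrier A \<and> m \<in> carrier M \<and> m' \<in> carrier M} \<union>
     {frag_of (r \<odot>\<^bsub>A\<^esub> a, m) - frag_of (a, r \<odot>\<^bsub>M\<^esub> m) | r a m.
        r \<in> carrier R \<and> a \<in> carrier A \<and> m \<in> carrier M}"

lemma basic_tensor_rels_carrier:
  assumes "op_closed R A" "op_closed R M"
  shows "basic_tensor_rels R A M \<subseteq> carrier (tensor_gens A M)"
  using assms unfolding op_closed_def
  by (auto dest!: subsetD[OF keys_diff])

lemma subgroup_tensor_rels:
  assumes "op_closed R A" "op_closed R M"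
  shows "subgroup (tensor_rels R A M) (tensor_gens A M)"
  unfolding tensor_rels_def
  by (rule group.generate_is_subgroup[OF group_free_Abelian_group basic_tensor_rels_carrier[OF assms]])

lemma tensor_rels_uminus:
  assumes "op_closed R A" "op_closed R M" "z \<in> tensor_rels R A M"
  shows "- z \<in> tensor_rels R A M"
  using subgroup.m_inv_closed[OF subgroup_tensor_rels[OF assms(1,2)] assms(3)]
    subgroup.mem_carrier[OF subgroup_tensor_rels[OF assms(1,2)] assms(3)]
  by simp

lemma tensor_rels_add:
  assumes "op_closed R A" "op_closed R M" "z \<in> tensor_rels R A M" "w \<in> tensor_rels R A M"
  shows "z + w \<in> tensor_rels R A M"
  using subgroup.m_closed[OF subgroup_tensor_rels[OF assms(1,2)] assms(3,4)] by simp

lemma pair_map_basic_tensor_rels: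
  assumes f: "f \<in> module_hom R A B" and z: "z \<in> basic_tensor_rels R A M"
  shows "pair_map f z \<in> basic_tensor_rels R B M"
proof -
  have c: "\<And>x. x \<in> carrier A \<Longrightarrow> f x \<in> carrier B"
    using f by (auto simp: module_hom_def)
  have a: "\<And>x y. x \<in> carrier A \<Longrightarrow> y \<in> carrier A \<Longrightarrow> f (x \<oplus>\<^bsub>A\<^esub> y) = f x \<oplus>\<^bsub>B\<^esub> f y"
    using f by (auto simp: module_hom_def)
  have s: "\<And>r x. r \<in> carrier R \<Longrightarrow> x \<in> carrier A \<Longrightarrow> f (r \<odot>\<^bsub>A\<^esub> x) = r \<odot>\<^bsub>B\<^esub> f x"
    using f by (auto simp: module_hom_def)
  from z consider
    (l) x y m where "z = frag_of (x \<oplus>\<^bsub>A\<^esub> y, m) - frag_of (x, m) - frag_of (y, m)"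
        "x \<in> carrier A" "y \<in> carrier A" "m \<in> carrier M"
  | (r) x m m' where "z = frag_of (x, m \<oplus>\<^bsub>M\<^esub> m') - frag_of (x, m) - frag_of (x, m')"
        "x \<in> carrier A" "m \<in> carrier M" "m' \<in> carrier M"
  | (b) r x m where "z = frag_of (r \<odot>\<^bsub>A\<^esub> x, m) - frag_of (x, r \<odot>\<^bsub>M\<^esub> m)"
        "r \<in> carrier R" "x \<in> carrier A" "m \<in> carrier M"
    by blast
  then show ?thesis
  proof cases
    case l
    then have "pair_map f z = frag_of (f x \<oplus>\<^bsub>B\<^esub> f y, m) - frag_of (f x, m) - frag_of (f y, m)"
      by (simp add: frag_extend_diff a)
    then show ?thesis using l c by blast
  next
    case r
    then have "pair_map f z = frag_of (f x, m \<oplus>\<^bsub>M\<^esub> m') - frag_of (f x, m) - frag_of (f x, m')"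
      by (simp add: frag_extend_diff)
    then show ?thesis using r c by blast
  next
    case b
    then have "pair_map f z = frag_of (r \<odot>\<^bsub>B\<^esub> f x, m) - frag_of (f x, r \<odot>\<^bsub>M\<^esub> m)"
      by (simp add: frag_extend_diff s)
    then show ?thesis using b c by blast
  qed
qed

text \<open>Functoriality of the tensor product in its first argument.\<close>

lemma pair_map_tensor_rels:
  assumes f: "f \<in> module_hom R A B" and A: "op_closed R A" and B: "op_closed R B"
    and M: "op_closed R M" and z: "z \<in> tensor_rels R A M"
  shows "pair_map f z \<in> tensor_rels R B M"
  using z unfolding tensor_rels_def[of R A M]
proof (induction rule: generate.induct)
  case one
  then show ?case
    using subgroup.one_closed[OF subgroup_tensor_rels[OF B M]] by simp
next
  case (incl h)
  then show ?case
    unfolding tensor_rels_def by (rule generate.incl[OF pair_map_basic_tensor_rels[OF f]])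
next
  case (inv h)
  have "pair_map f h \<in> tensor_rels R B M"
    unfolding tensor_rels_def by (rule generate.incl[OF pair_map_basic_tensor_rels[OF f inv]])
  moreover have "inv\<^bsub>tensor_gens A M\<^esub> h = - h"
    using subsetD[OF basic_tensor_rels_carrier[OF A M] inv]
    by (intro inv_free_Abelian_group) (simp only: carrier_free_Abelian_group_iff)
  ultimately show ?case
    by (simp only: frag_extend_minus tensor_rels_uminus[OF B M])
next
  case (eng h1 h2)
  then show ?case by (simp add: frag_extend_add tensor_rels_add[OF B M])
qed

text \<open>A retraction \<open>g\<close> of \<open>f\<close> induces a retraction of \<open>f \<otimes> M\<close>. Concretely: if two classes have the
  same image then \<open>f\<close> applied to a difference of representatives is a relation, and applying \<open>g\<close>
  turns it back into that difference.\<close>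

lemma pure_hom_if_retraction:
  fixes T :: "'m itself" and R :: "('a, 'x) ring_scheme"
  assumes f: "f \<in> module_hom R A B" and g: "g \<in> module_hom R B A"
    and gf: "\<And>x. x \<in> carrier A \<Longrightarrow> g (f x) = x"
    and A: "op_closed R A" and B: "op_closed R B"
  shows "pure_hom T R A B f"
  unfolding pure_hom_def
proof (intro conjI allI impI f inj_onI)
  fix M :: "('a, 'm) module" and X X'
  assume "module R M"
  then have M: "op_closed R M" by (rule module_op_closed)
  let ?GA = "tensor_gens A M" and ?GB = "tensor_gens B M"
  let ?HA = "tensor_rels R A M" and ?HB = "tensor_rels R B M"
  note sub = subgroup_tensor_rels[OF A M]
  have retr: "pair_map g (pair_map f z) = z" if "z \<in> carrier ?GA" for z
  proof -
    have "Poly_Mapping.keys z \<subseteq> carrier A \<times> carrier M" using that by simp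
    then show ?thesis
      by (rule free_Abelian_group_induct) (auto simp: frag_extend_diff gf)
  qed
  assume "X \<in> carrier (tensor_product R A M)" "X' \<in> carrier (tensor_product R A M)"
  then obtain z z' where z: "z \<in> carrier ?GA" "X = ?HA #>\<^bsub>?GA\<^esub> z"
    and z': "z' \<in> carrier ?GA" "X' = ?HA #>\<^bsub>?GA\<^esub> z'"
    unfolding tensor_product_def FactGroup_def RCOSETS_def by auto
  assume eq: "tensor_map R A B M f X = tensor_map R A B M f X'"
  have "0 \<in> ?HA" "0 \<in> ?HB"
    using subgroup.one_closed[OF sub] subgroup.one_closed[OF subgroup_tensor_rels[OF B M]] by simp_all
  then have "z \<in> X" "pair_map f z \<in> ?HB #>\<^bsub>?GB\<^esub> pair_map f z"
    unfolding z(2) r_coset_def by force+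
  then have "pair_map f z \<in> tensor_map R A B M f X"
    unfolding tensor_map_def by (rule UN_I)
  then have "pair_map f z \<in> tensor_map R A B M f X'"
    using eq by simp
  then obtain w where w: "w \<in> X'" and "pair_map f z \<in> ?HB #>\<^bsub>?GB\<^esub> pair_map f w"
    unfolding tensor_map_def by (rule UN_E)
  then obtain b where b: "b \<in> ?HB" "pair_map f z = b + pair_map f w"
    unfolding r_coset_def mult_free_Abelian_group by blast
  obtain a where a: "a \<in> ?HA" "w = a + z'"
    using w unfolding z'(2) r_coset_def mult_free_Abelian_group by blast
  have wc: "w \<in> carrier ?GA"
    using subgroup.mem_carrier[OF sub a(1)] z'(1) a(2) keys_add[of a z'] by auto
  have "pair_map f (z - w) = b" using b(2) by (simp add: frag_extend_diff)
  moreover have "z - w \<in> carrier ?GA" using z(1) wc keys_diff[of z w] by auto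
  ultimately have "z - w = pair_map g b" using retr by metis
  then have "z - w \<in> ?HA" using pair_map_tensor_rels[OF g B A M b(1)] by simp
  then have "(z - w) + a \<in> ?HA" using a(1) by (rule tensor_rels_add[OF A M])
  moreover have "z = (z - w + a) + z'" using a(2) by simp
  ultimately have "z \<in> ?HA #>\<^bsub>?GA\<^esub> z'" unfolding r_coset_def by force
  then show "X = X'"
    unfolding z(2) z'(2)
    using group.repr_independence[OF group_free_Abelian_group _ z'(1) sub] by metis
qed

section \<open>F-purity of a quotient by a compatibly split ideal\<close>

text \<open>A Frobenius splitting \<open>\<phi>\<close> of \<open>S\<close> that maps \<open>J\<close> into itself descends to a retraction of the
  Frobenius of \<open>S / J\<close>, by \<open>J + a \<mapsto> J + \<phi> a\<close>. Additivity of Frobenius on \<open>S\<close> is a hypothesis, since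
  in an application it comes with the characteristic.\<close>

lemma F_pure_quotient_if_compatible_splitting:
  fixes S (structure) and T :: "'m itself"
  assumes "cring S" and "ideal J S" and p: "prime p" "[p] \<cdot> \<one> = \<zero>"
    and frob_add: "\<And>a b. a \<in> carrier S \<Longrightarrow> b \<in> carrier S \<Longrightarrow> (a \<oplus> b) [^] p = a [^] p \<oplus> b [^] p"
    and closed: "\<And>a. a \<in> carrier S \<Longrightarrow> \<phi> a \<in> carrier S"
    and add: "\<And>a b. a \<in> carrier S \<Longrightarrow> b \<in> carrier S \<Longrightarrow> \<phi> (a \<oplus> b) = \<phi> a \<oplus> \<phi> b"
    and semilinear: "\<And>r a. r \<in> carrier S \<Longrightarrow> a \<in> carrier S \<Longrightarrow> \<phi> (r [^] p \<otimes> a) = r \<otimes> \<phi> a"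
    and one: "\<phi> \<one> = \<one>"
    and compatible: "\<And>a. a \<in> J \<Longrightarrow> \<phi> a \<in> J"
    and proper: "\<one> \<notin> J"
  shows "F_pure T p (S Quot J)"
proof -
  interpret S: cring S by fact
  interpret J: ideal J S by fact
  let ?R = "S Quot J"
  interpret R: cring ?R by (rule J.quotient_is_cring[OF \<open>cring S\<close>])
  interpret \<pi>: ring_hom_cring S ?R "(+>) J" by (rule J.rcos_ring_hom_cring[OF \<open>cring S\<close>])
  have rep: "\<exists>a\<in>carrier S. X = J +> a" if "X \<in> carrier ?R" for X
    using that unfolding FactRing_def A_RCOSETS_def' by simp
  have eq_iff: "J +> a = J +> b \<longleftrightarrow> a \<ominus> b \<in> J" if "a \<in> carrier S" "b \<in> carrier S" for a b
    by (rule S.quotient_eq_iff_same_a_r_cos[OF \<open>ideal J S\<close> that, symmetric])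
  define \<theta> where "\<theta> = (\<lambda>X. J +> \<phi> (SOME a. a \<in> carrier S \<and> X = J +> a))"
  have \<theta>: "\<theta> (J +> a) = J +> \<phi> a" if a: "a \<in> carrier S" for a
  proof -
    define b where "b = (SOME b. b \<in> carrier S \<and> J +> a = J +> b)"
    have b: "b \<in> carrier S \<and> J +> a = J +> b"
      unfolding b_def by (rule someI[of _ a]) (use a in simp)
    then have ba: "b \<ominus> a \<in> J" using eq_iff[of b a] a by metis
    have "\<phi> b = \<phi> ((b \<ominus> a) \<oplus> a)" using a b by (simp add: S.minus_eq S.a_assoc S.l_neg)
    also have "\<dots> = \<phi> (b \<ominus> a) \<oplus> \<phi> a" using a b by (simp add: add)
    finally have "\<phi> b \<ominus> \<phi> a = \<phi> (b \<ominus> a)"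
      using a b closed by (simp add: S.minus_eq S.a_assoc S.r_neg)
    then have "\<phi> b \<ominus> \<phi> a \<in> J" using compatible[OF ba] by simp
    then show ?thesis
      unfolding \<theta>_def b_def[symmetric] using eq_iff a b closed by metis
  qed
  have R_add: "(J +> a) \<oplus>\<^bsub>?R\<^esub> (J +> b) = J +> (a \<oplus> b)" if "a \<in> carrier S" "b \<in> carrier S" for a b
    by (rule \<pi>.hom_add[OF that, symmetric])
  have R_mult: "(J +> a) \<otimes>\<^bsub>?R\<^esub> (J +> b) = J +> (a \<otimes> b)" if "a \<in> carrier S" "b \<in> carrier S" for a b
    by (rule \<pi>.hom_mult[OF that, symmetric])
  have R_pow: "(J +> a) [^]\<^bsub>?R\<^esub> k = J +> (a [^] k)" if "a \<in> carrier S" for a and k :: nat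
    by (induction k) (simp_all only: S.nat_pow_0 R.nat_pow_0 \<pi>.hom_one S.nat_pow_Suc R.nat_pow_Suc
        R_mult that S.nat_pow_closed)
  have frob_hom: "(x \<oplus>\<^bsub>?R\<^esub> y) [^]\<^bsub>?R\<^esub> p = x [^]\<^bsub>?R\<^esub> p \<oplus>\<^bsub>?R\<^esub> y [^]\<^bsub>?R\<^esub> p"
    if car: "x \<in> carrier ?R" "y \<in> carrier ?R" for x y
  proof -
    obtain a b where ab: "a \<in> carrier S" "b \<in> carrier S" and xy: "x = J +> a" "y = J +> b"
      using rep[OF car(1)] rep[OF car(2)] by (elim bexE)
    show ?thesis
      by (simp only: xy R_add R_pow ab S.a_closed S.nat_pow_closed frob_add)
  qed
  have frob: "(\<lambda>x. x [^]\<^bsub>?R\<^esub> p) \<in> module_hom ?R (self_module ?R) (frobenius_module p ?R)"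
    unfolding module_hom_def self_module_def frobenius_module_def
    by (intro CollectI conjI ballI funcsetI)
      (simp_all only: partial_object.select_convs monoid.select_convs ring.select_convs
        module.select_convs R.nat_pow_closed frob_hom R.nat_pow_distrib)
  have \<theta>_closed: "\<theta> x \<in> carrier ?R" if "x \<in> carrier ?R" for x
    using rep[OF that] \<theta> closed \<pi>.hom_closed by metis
  have \<theta>_add: "\<theta> (x \<oplus>\<^bsub>?R\<^esub> y) = \<theta> x \<oplus>\<^bsub>?R\<^esub> \<theta> y" if car: "x \<in> carrier ?R" "y \<in> carrier ?R" for x y
  proof -
    obtain a b where ab: "a \<in> carrier S" "b \<in> carrier S" and xy: "x = J +> a" "y = J +> b"
      using rep[OF car(1)] rep[OF car(2)] by (elim bexE)
    show ?thesis
      by (simp only: xy R_add \<theta> ab S.a_closed closed add)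
  qed
  have \<theta>_smult: "\<theta> (r [^]\<^bsub>?R\<^esub> p \<otimes>\<^bsub>?R\<^esub> x) = r \<otimes>\<^bsub>?R\<^esub> \<theta> x"
    if car: "r \<in> carrier ?R" "x \<in> carrier ?R" for r x
  proof -
    obtain a b where ab: "a \<in> carrier S" "b \<in> carrier S" and xy: "r = J +> a" "x = J +> b"
      using rep[OF car(1)] rep[OF car(2)] by (elim bexE)
    show ?thesis
      by (simp only: xy R_mult R_pow \<theta> ab S.m_closed S.nat_pow_closed closed semilinear)
  qed
  have retr: "\<theta> \<in> module_hom ?R (frobenius_module p ?R) (self_module ?R)"
    unfolding module_hom_def self_module_def frobenius_module_def
    by (intro CollectI conjI ballI funcsetI)
      (simp_all only: partial_object.select_convs monoid.select_convs ring.select_convs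
        module.select_convs \<theta>_closed \<theta>_add \<theta>_smult)
  have "pure_hom T ?R (self_module ?R) (frobenius_module p ?R) (\<lambda>x. x [^]\<^bsub>?R\<^esub> p)"
  proof (rule pure_hom_if_retraction[OF frob retr])
    fix x assume "x \<in> carrier (self_module ?R)"
    then obtain a where a: "a \<in> carrier S" "x = J +> a"
      using rep unfolding self_module_def by (metis partial_object.select_convs(1))
    have "\<phi> (a [^] p) = a" using semilinear[OF a(1) S.one_closed] a(1) one by simp
    then show "\<theta> (x [^]\<^bsub>?R\<^esub> p) = x"
      by (simp only: a R_pow \<theta> S.nat_pow_closed)
  qed (simp_all add: op_closed_def self_module_def frobenius_module_def)
  moreover have "\<one>\<^bsub>?R\<^esub> \<noteq> \<zero>\<^bsub>?R\<^esub>"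
  proof
    assume "\<one>\<^bsub>?R\<^esub> = \<zero>\<^bsub>?R\<^esub>"
    then have "J +> \<one> = J +> \<zero>" by (simp only: \<pi>.hom_one \<pi>.hom_zero)
    then have "\<one> \<ominus> \<zero> \<in> J" by (simp only: eq_iff S.one_closed S.zero_closed)
    moreover have "\<one> \<ominus> \<zero> = \<one>" by (simp add: S.minus_eq)
    ultimately show False using proper by (simp only:)
  qed
  moreover have "[p] \<cdot>\<^bsub>?R\<^esub> \<one>\<^bsub>?R\<^esub> = \<zero>\<^bsub>?R\<^esub>"
  proof -
    have "J +> ([k] \<cdot> \<one>) = [k] \<cdot>\<^bsub>?R\<^esub> \<one>\<^bsub>?R\<^esub>" for k :: nat
      by (induction k) (simp_all only: S.add.nat_pow_0 R.add.nat_pow_0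
        S.add.nat_pow_Suc R.add.nat_pow_Suc \<pi>.hom_zero \<pi>.hom_one \<pi>.hom_add S.add.nat_pow_closed S.one_closed)
    then show ?thesis using p(2) \<pi>.hom_zero by metis
  qed
  ultimately show ?thesis
    unfolding F_pure_def using p(1) R.is_cring by simp
qed

section \<open>Polynomials as finitely supported maps\<close>

abbreviation "single \<equiv> Poly_Mapping.single"
abbreviation "lookup \<equiv> Poly_Mapping.lookup"
abbreviation "keys \<equiv> Poly_Mapping.keys"

text \<open>Reduces statements that are additive in a polynomial to monomials.\<close>

lemma single_add_induct [case_names zero single_add]:
  assumes "P 0" and "\<And>m a g. P g \<Longrightarrow> P (single m a + g)"
  shows "P (g :: 'm \<Rightarrow>\<^sub>0 'a::comm_monoid_add)"
proof (induction g rule: Poly_Mapping.update_induct)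
  case (update f a b)
  have "Poly_Mapping.update a b f = single a b + f"
    by (rule poly_mapping_eqI)
      (use update(1) in \<open>auto simp: lookup_update lookup_add lookup_single in_keys_iff\<close>)
  then show ?case using assms(2)[OF update(3)] by simp
qed (rule assms(1))

text \<open>This lemma and the next determine every coefficient of a product with a monomial.\<close>

lemma lookup_single_mult_add:
  fixes g :: "('v \<Rightarrow>\<^sub>0 nat) \<Rightarrow>\<^sub>0 'k::comm_semiring_1"
  shows "lookup (single k a * g) (k + m) = a * lookup g m"
  by (induction g rule: single_add_induct)
    (simp_all add: distrib_left lookup_add mult_single lookup_single when_def)

lemma lookup_single_mult_eq_0:
  fixes g :: "('v \<Rightarrow>\<^sub>0 nat) \<Rightarrow>\<^sub>0 'k::comm_semiring_1"
  assumes "\<And>m'. m \<noteq> k + m'"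
  shows "lookup (single k a * g) m = 0"
  by (induction g rule: single_add_induct)
    (simp_all add: distrib_left lookup_add mult_single lookup_single assms[symmetric])

lemma keys_mult_exE:
  fixes f g :: "('v \<Rightarrow>\<^sub>0 nat) \<Rightarrow>\<^sub>0 'k::comm_semiring_1"
  assumes "m \<in> keys (f * g)"
  obtains m1 m2 where "m = m1 + m2" "m1 \<in> keys f" "m2 \<in> keys g"
  using assms keys_mult[of f g] by blast

definition scale :: "nat \<Rightarrow> ('v \<Rightarrow>\<^sub>0 nat) \<Rightarrow> ('v \<Rightarrow>\<^sub>0 nat)" where
  "scale q m = Poly_Mapping.map ((*) q) m"

lemma lookup_scale [simp]: "lookup (scale q m) v = q * lookup m v"
  unfolding scale_def by (simp add: map.rep_eq when_def)

lemma scale_0 [simp]: "scale q 0 = 0" "scale 0 m = 0"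
  by (rule poly_mapping_eqI, simp)+

lemma scale_add: "scale q (m + m') = scale q m + scale q m'"
  by (rule poly_mapping_eqI) (simp add: lookup_add algebra_simps)

lemma scale_Suc: "scale (Suc q) m = m + scale q m"
  by (rule poly_mapping_eqI) (simp add: lookup_add)

lemma single_power:
  fixes a :: "'k::comm_semiring_1"
  shows "single (m :: 'v \<Rightarrow>\<^sub>0 nat) a ^ q = single (scale q m) (a ^ q)"
  by (induction q) (simp_all add: scale_Suc mult_single)

lemma CHAR_poly: "CHAR(('v \<Rightarrow>\<^sub>0 nat) \<Rightarrow>\<^sub>0 'k::field) = CHAR('k)"
proof -
  have *: "(of_nat j = (0 :: ('v \<Rightarrow>\<^sub>0 nat) \<Rightarrow>\<^sub>0 'k)) \<longleftrightarrow> of_nat j = (0 :: 'k)" for j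
    using inj_single[of "0 :: 'v \<Rightarrow>\<^sub>0 nat", THEN inj_eq, of "of_nat j :: 'k" 0] by simp
  then show ?thesis
    using *[of "CHAR('k)"] *[of "CHAR(('v \<Rightarrow>\<^sub>0 nat) \<Rightarrow>\<^sub>0 'k)"]
    by (intro dvd_antisym) (simp_all flip: of_nat_eq_0_iff_char_dvd)
qed

section \<open>The trace of Frobenius\<close>

text \<open>The trace is formed with respect to an arbitrary exponent \<open>c\<close> with entries below \<open>p\<close>: it reads off
  the component at \<open>X\<^sup>c\<close> of a polynomial over its subring of \<open>p\<close>-th powers and extracts the root.
  The bound on \<open>c\<close> is what makes it semilinear. The binomial edge ideals use entries \<open>p - 1\<close>.\<close>

locale frobenius_trace =
  fixes p :: nat and c :: "'v \<Rightarrow>\<^sub>0 nat" and T :: "'k::field itself"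
  assumes char: "CHAR('k) = p" and p_pos: "p > 0"
    and surj: "surj (\<lambda>x :: 'k. x ^ p)"
    and small: "\<And>v. lookup c v < p"
begin

lemma prime_p: "prime p"
  using prime_CHAR_semidom[where ?'a = 'k] p_pos unfolding char by blast

lemma frob_add: "(a + b :: 'k) ^ p = a ^ p + b ^ p"
  by (rule freshmans_dream) (simp_all only: char prime_p)

lemma frob_add_poly: "(f + g :: ('v \<Rightarrow>\<^sub>0 nat) \<Rightarrow>\<^sub>0 'k) ^ p = f ^ p + g ^ p"
  by (rule freshmans_dream) (simp_all only: CHAR_poly char prime_p)

definition pth_root :: "'k \<Rightarrow> 'k" where
  "pth_root = inv_into UNIV (\<lambda>x. x ^ p)"

lemma inj_frob: "inj (\<lambda>x :: 'k. x ^ p)"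
proof (rule injI)
  fix a b :: 'k assume "a ^ p = b ^ p"
  moreover have "a ^ p = (a - b) ^ p + b ^ p" using frob_add[of "a - b" b] by simp
  ultimately show "a = b" by simp
qed

lemma pth_root_power [simp]: "pth_root (a ^ p) = a"
  unfolding pth_root_def using inv_into_f_f[OF inj_frob, of a] by simp

lemma power_pth_root [simp]: "pth_root a ^ p = a"
  unfolding pth_root_def using f_inv_into_f[of a "\<lambda>x. x ^ p" UNIV] surj by simp

lemma pth_root_0 [simp]: "pth_root 0 = 0" and pth_root_1 [simp]: "pth_root 1 = 1"
  using pth_root_power[of 0] pth_root_power[of 1] p_pos by (simp_all add: power_0_left)

lemma pth_root_add: "pth_root (a + b) = pth_root a + pth_root b"
  by (metis frob_add power_pth_root pth_root_power)

lemma pth_root_mult: "pth_root (a ^ p * b) = a * pth_root b"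
  by (metis power_mult_distrib power_pth_root pth_root_power)

lemma inj_scale_shift: "inj (\<lambda>m. scale p m + c)"
proof (rule injI)
  fix m m' assume "scale p m + c = scale p m' + c"
  then have "lookup (scale p m) v = lookup (scale p m') v" for v by simp
  then show "m = m'" using p_pos by (intro poly_mapping_eqI) simp
qed

definition tr :: "(('v \<Rightarrow>\<^sub>0 nat) \<Rightarrow>\<^sub>0 'k) \<Rightarrow> (('v \<Rightarrow>\<^sub>0 nat) \<Rightarrow>\<^sub>0 'k)" where
  "tr g = Poly_Mapping.map pth_root (Poly_Mapping.map_key (\<lambda>m. scale p m + c) g)"

lemma lookup_tr: "lookup (tr g) m = pth_root (lookup g (scale p m + c))"
  unfolding tr_def by (simp add: map.rep_eq map_key.rep_eq[OF inj_scale_shift] when_def)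

lemma keys_tr: "m \<in> keys (tr g) \<Longrightarrow> scale p m + c \<in> keys g"
  by (auto simp: in_keys_iff lookup_tr)

lemma tr_0 [simp]: "tr 0 = 0"
  by (rule poly_mapping_eqI) (simp add: lookup_tr)

lemma tr_add: "tr (f + g) = tr f + tr g"
  by (rule poly_mapping_eqI) (simp add: lookup_tr lookup_add pth_root_add)

text \<open>If \<open>X\<^sup>p\<^sup>k\<close> divides \<open>X\<^sup>p\<^sup>m\<^sup>+\<^sup>c\<close> then \<open>X\<^sup>k\<close> divides \<open>X\<^sup>m\<close>, because the entries of \<open>c\<close> are too small to
  contribute another \<open>p\<close>-th power.\<close>

lemma scale_le_scale_shift:
  assumes "scale p m + c = scale p k + m'"
  shows "\<exists>m''. m = k + m''"
proof -
  have "lookup k v \<le> lookup m v" for v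
  proof (rule ccontr)
    assume "\<not> ?thesis"
    then have "p * Suc (lookup m v) \<le> p * lookup k v" by (intro mult_le_mono) auto
    moreover have "p * lookup m v + lookup c v = p * lookup k v + lookup m' v"
      using arg_cong[OF assms, of "\<lambda>m. lookup m v"] by (simp add: lookup_add)
    ultimately show False using small[of v] by simp
  qed
  then have "m = k + (m - k)"
    by (intro poly_mapping_eqI) (simp add: lookup_add lookup_minus)
  then show ?thesis by blast
qed

lemma tr_single_power_mult: "tr (single k a ^ p * g) = single k a * tr g"
proof (rule poly_mapping_eqI)
  fix m
  show "lookup (tr (single k a ^ p * g)) m = lookup (single k a * tr g) m"
  proof (cases "\<exists>m'. m = k + m'")
    case True
    then obtain m' where "m = k + m'" by blast
    then show ?thesis
      by (simp add: lookup_tr single_power scale_add add.assoc lookup_single_mult_add pth_root_mult)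
  next
    case False
    then have "scale p m + c \<noteq> scale p k + m'" for m'
      using scale_le_scale_shift by blast
    then show ?thesis
      using False by (simp add: lookup_tr single_power lookup_single_mult_eq_0)
  qed
qed

lemma tr_power_mult: "tr (h ^ p * g) = h * tr g"
proof (induction h rule: single_add_induct)
  case zero
  then show ?case using p_pos by (simp add: power_0_left)
next
  case (single_add m a h)
  then show ?case by (simp add: frob_add_poly distrib_right tr_add tr_single_power_mult)
qed

end

section \<open>Minors and column degrees\<close>

definition minor :: "nat \<Rightarrow> nat \<Rightarrow> 'k::field xy_poly" where
  "minor a b = var (VarX a) * var (VarY b) - var (VarX b) * var (VarY a)"

lemma minor_eq_monomials:
  "minor a b = single (single (VarX a) 1 + single (VarY b) 1) 1
    - single (single (VarX b) 1 + single (VarY a) 1) 1"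
  by (simp add: minor_def var_def mult_single)

lemma minor_swap: "minor b a = - minor a b"
  by (simp add: minor_def)

lemma minor_self [simp]: "minor a a = 0"
  by (simp add: minor_def)

text \<open>Expansion of a vanishing 3 by 3 determinant in which the \<open>x\<close>-row or the \<open>y\<close>-row is repeated.\<close>

lemma pluecker:
  assumes "z = VarX \<or> z = VarY"
  shows "var (z c) * minor a b = var (z a) * minor c b - var (z b) * minor c a"
  using assms by (elim disjE) (simp_all add: minor_def algebra_simps)

definition col_deg :: "nat \<Rightarrow> (xy_var \<Rightarrow>\<^sub>0 nat) \<Rightarrow> nat" where
  "col_deg v m = lookup m (VarX v) + lookup m (VarY v)"

lemma col_deg_add [simp]: "col_deg v (m + m') = col_deg v m + col_deg v m'"
  by (simp add: col_deg_def lookup_add)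

lemma col_deg_0 [simp]: "col_deg v 0 = 0"
  by (simp add: col_deg_def)

lemma col_deg_single [simp]:
  "col_deg v (single (VarX w) a) = (if v = w then a else 0)"
  "col_deg v (single (VarY w) a) = (if v = w then a else 0)"
  by (simp_all add: col_deg_def lookup_single when_def)

lemma extract_variable:
  fixes m :: "'v \<Rightarrow>\<^sub>0 nat"
  assumes "lookup m v > 0"
  obtains m' where "m = single v 1 + m'" "keys m' \<subseteq> keys m"
proof
  show "m = single v 1 + (m - single v 1)"
    by (rule poly_mapping_eqI) (use assms in \<open>auto simp: lookup_add lookup_minus lookup_single when_def\<close>)
  show "keys (m - single v 1) \<subseteq> keys m"
    by (auto simp: in_keys_iff lookup_minus)
qed

lemma extract_column:
  assumes "col_deg v m > 0"
  obtains z m' where "z = VarX \<or> z = VarY" "m = single (z v) 1 + m'" "keys m' \<subseteq> keys m"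
  using assms unfolding col_deg_def by (metis add_gr_0 extract_variable)

section \<open>The ideal of all minors on a set of columns\<close>

text \<open>For finite \<open>W\<close>, two monomials are congruent modulo the minors on the columns in \<open>W\<close> exactly if they agree outside
  these columns, have the same degree in each of them, and the same total degree in their
  \<open>y\<close>-variables. The encoding stores a column degree at \<open>x\<^sub>w\<close> and repeats the total \<open>y\<close>-degree at every
  \<open>y\<^sub>w\<close>.\<close>

definition toric_class :: "nat set \<Rightarrow> (xy_var \<Rightarrow>\<^sub>0 nat) \<Rightarrow> xy_var \<Rightarrow> nat" where
  "toric_class W m v = (case v of
      VarX w \<Rightarrow> if w \<in> W then col_deg w m else lookup m v
    | VarY w \<Rightarrow> if w \<in> W then (\<Sum>w\<in>W. lookup m (VarY w)) else lookup m v)"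

lemma toric_class_add: "toric_class W (m + m') v = toric_class W m v + toric_class W m' v"
  by (simp add: toric_class_def lookup_add sum.distrib split: xy_var.split)

lemma toric_class_swap:
  assumes "finite W" "a \<in> W" "b \<in> W"
  shows "toric_class W (single (VarX a) 1 + single (VarY b) 1)
       = toric_class W (single (VarX b) 1 + single (VarY a) 1)"
proof
  have *: "(\<Sum>w\<in>W. lookup (single (VarY c) (1 :: nat)) (VarY w)) = 1" if "c \<in> W" for c
    using that assms(1) by (simp add: lookup_single when_def)
  fix v
  show "toric_class W (single (VarX a) 1 + single (VarY b) 1) v
       = toric_class W (single (VarX b) 1 + single (VarY a) 1) v"
    using *[OF assms(2)] *[OF assms(3)] assms
    by (auto simp: toric_class_def lookup_add sum.distrib lookup_single when_def split: xy_var.split)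
qed

definition class_sum :: "nat set \<Rightarrow> 'k::field xy_poly \<Rightarrow> (xy_var \<Rightarrow> nat) \<Rightarrow> 'k" where
  "class_sum W h c = (\<Sum>m\<in>keys h. lookup h m when toric_class W m = c)"

lemma class_sum_0 [simp]: "class_sum W 0 c = 0"
  by (simp add: class_sum_def)

lemma class_sum_add: "class_sum W (f + g) c = class_sum W f c + class_sum W g c"
  unfolding class_sum_def
  by (rule setsum_keys_plus_distrib) (simp_all add: when_def)

lemma class_sum_diff: "class_sum W (f - g) c = class_sum W f c - class_sum W g c"
  using class_sum_add[of W "f - g" g c] by simp

lemma class_sum_single: "class_sum W (single m a) c = (a when toric_class W m = c)"
  by (cases "a = 0") (simp_all add: class_sum_def)

lemma class_sum_single_mult:
  "class_sum W (single k a * h) (\<lambda>v. toric_class W k v + c v) = a * class_sum W h c"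
proof (induction h rule: single_add_induct)
  case (single_add m b h)
  have "toric_class W (k + m) = (\<lambda>v. toric_class W k v + c v) \<longleftrightarrow> toric_class W m = c"
    by (simp add: fun_eq_iff toric_class_add)
  then show ?case
    using single_add by (simp add: distrib_left class_sum_add class_sum_single mult_single when_def)
qed simp

lemma class_sum_cong_mult:
  assumes "toric_class W k = toric_class W k'"
  shows "class_sum W (single k a * h) c = class_sum W (single k' a * h) c"
proof (induction h rule: single_add_induct)
  case (single_add m b h)
  have "toric_class W (k + m) = toric_class W (k' + m)"
    by (simp add: fun_eq_iff toric_class_add assms)
  then show ?case
    using single_add by (simp add: distrib_left class_sum_add class_sum_single mult_single)
qed simp

text \<open>The kernel of the map that identifies monomials of the same class; for finite \<open>W\<close> it is the prime
  ideal generated by the minors on \<open>W\<close>. This form makes cancellation of variables evident, since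
  multiplication by a monomial is injective on classes.\<close>

definition toric_ideal :: "nat set \<Rightarrow> 'k::field xy_poly set" where
  "toric_ideal W = {h. \<forall>c. class_sum W h c = 0}"

lemma toric_ideal_add: "f \<in> toric_ideal W \<Longrightarrow> g \<in> toric_ideal W \<Longrightarrow> f + g \<in> toric_ideal W"
  by (simp add: toric_ideal_def class_sum_add)

lemma minor_mult_in_toric_ideal:
  assumes "finite W" "a \<in> W" "b \<in> W"
  shows "minor a b * g \<in> toric_ideal W"
  unfolding toric_ideal_def minor_eq_monomials
  using class_sum_cong_mult[OF toric_class_swap[OF assms], of 1 g]
  by (simp add: left_diff_distrib class_sum_diff)

text \<open>Multiplication by \<open>x\<^sub>v\<close> or \<open>y\<^sub>v\<close> only translates the family of class sums.\<close>

lemma toric_ideal_cancel_variable: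
  assumes "var v * h \<in> toric_ideal W"
  shows "h \<in> toric_ideal W"
proof -
  have "class_sum W h c = 0" for c
    using assms class_sum_single_mult[of W "single v 1" 1 h c]
    by (simp add: toric_ideal_def var_def)
  then show ?thesis by (simp add: toric_ideal_def)
qed

section \<open>The polynomial ring and its ideals\<close>

lemma in_xy_ring: "f \<in> carrier (xy_ring n) \<longleftrightarrow> (\<forall>m\<in>keys f. keys m \<subseteq> xy_vars n)"
  by (simp add: xy_ring_def)

lemma xy_ring_sels [simp]:
  "f \<otimes>\<^bsub>xy_ring n\<^esub> g = f * g" "f \<oplus>\<^bsub>xy_ring n\<^esub> g = f + g"
  "\<one>\<^bsub>xy_ring n\<^esub> = 1" "\<zero>\<^bsub>xy_ring n\<^esub> = 0"
  by (simp_all add: xy_ring_def)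

lemma xy_ring_0: "0 \<in> carrier (xy_ring n)" and xy_ring_1: "1 \<in> carrier (xy_ring n)"
  by (simp_all add: in_xy_ring)

lemma xy_ring_add:
  "f \<in> carrier (xy_ring n) \<Longrightarrow> g \<in> carrier (xy_ring n) \<Longrightarrow> f + g \<in> carrier (xy_ring n)"
  using keys_add[of f g] by (auto simp: in_xy_ring)

lemma xy_ring_uminus: "f \<in> carrier (xy_ring n) \<Longrightarrow> - f \<in> carrier (xy_ring n)"
  by (auto simp: in_xy_ring in_keys_iff)

lemma xy_ring_diff:
  "f \<in> carrier (xy_ring n) \<Longrightarrow> g \<in> carrier (xy_ring n) \<Longrightarrow> f - g \<in> carrier (xy_ring n)"
  using xy_ring_add[of f n "- g"] xy_ring_uminus[of g n] by simp

lemma xy_ring_mult: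
  assumes "f \<in> carrier (xy_ring n)" "g \<in> carrier (xy_ring n)"
  shows "f * g \<in> carrier (xy_ring n)"
  unfolding in_xy_ring
proof
  fix m assume "m \<in> keys (f * g)"
  then obtain m1 m2 where "m = m1 + m2" "m1 \<in> keys f" "m2 \<in> keys g"
    by (rule keys_mult_exE)
  then show "keys m \<subseteq> xy_vars n"
    using assms keys_add[of m1 m2] unfolding in_xy_ring by blast
qed

lemma xy_ring_power: "f \<in> carrier (xy_ring n) \<Longrightarrow> f ^ q \<in> carrier (xy_ring n)"
  by (induction q) (simp_all add: xy_ring_1 xy_ring_mult)

lemma xy_ring_single: "keys m \<subseteq> xy_vars n \<Longrightarrow> single m a \<in> carrier (xy_ring n)"
  by (simp add: in_xy_ring)

lemma xy_ring_var: "v \<in> xy_vars n \<Longrightarrow> var v \<in> carrier (xy_ring n)"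
  unfolding var_def by (intro xy_ring_single) simp

lemma xy_vars_iff [simp]:
  "VarX v \<in> xy_vars n \<longleftrightarrow> v \<in> {1..n}" "VarY v \<in> xy_vars n \<longleftrightarrow> v \<in> {1..n}"
  by (auto simp: xy_vars_def)

lemma xy_ring_minor: "a \<in> {1..n} \<Longrightarrow> b \<in> {1..n} \<Longrightarrow> minor a b \<in> carrier (xy_ring n)"
  unfolding minor_def by (intro xy_ring_diff xy_ring_mult xy_ring_var) simp_all

lemma xy_ring_prod:
  "(\<And>j. j \<in> A \<Longrightarrow> f j \<in> carrier (xy_ring n)) \<Longrightarrow> (\<Prod>j\<in>A. f j) \<in> carrier (xy_ring n)"
  by (induction A rule: infinite_finite_induct) (simp_all add: xy_ring_1 xy_ring_mult)

text \<open>An ideal of \<open>xy_ring n\<close> in terms of the arithmetic of the ambient polynomial type; its elements need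
  not lie in \<open>xy_ring n\<close>, so that kernels of maps on the whole type qualify.\<close>

locale xy_ideal =
  fixes n :: nat and I :: "'k::field xy_poly set"
  assumes zero: "0 \<in> I"
    and add: "\<And>f g. f \<in> I \<Longrightarrow> g \<in> I \<Longrightarrow> f + g \<in> I"
    and mult: "\<And>f g. g \<in> carrier (xy_ring n) \<Longrightarrow> f \<in> I \<Longrightarrow> g * f \<in> I"
begin

lemma uminus: "f \<in> I \<Longrightarrow> - f \<in> I"
  using mult[OF xy_ring_uminus[OF xy_ring_1], of f] by simp

lemma diff: "f \<in> I \<Longrightarrow> g \<in> I \<Longrightarrow> f - g \<in> I"
  using add[of f "- g"] uminus[of g] by simp

lemma minor_sym: "minor a b \<in> I \<Longrightarrow> minor b a \<in> I"
  by (subst minor_swap) (rule uminus)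

text \<open>Two neighbours of \<open>c\<close> become adjacent after multiplication by a variable in the column of \<open>c\<close>.\<close>

lemma common_neighbour:
  assumes "z = VarX \<or> z = VarY" "a \<in> {1..n}" "b \<in> {1..n}" "minor c a \<in> I" "minor c b \<in> I"
  shows "var (z c) * minor a b \<in> I"
  using assms by (subst pluecker[OF assms(1)]) (intro diff mult xy_ring_var; auto)

end

section \<open>Edges whose ends dominate a set of vertices\<close>

text \<open>Here \<open>minor a b \<in> I\<close> plays the role of adjacency of \<open>a\<close> and \<open>b\<close>, and \<open>b = i\<close> and \<open>b = k\<close> satisfy the
  last condition trivially.\<close>

locale dominating_edge = xy_ideal n I
  for n :: nat and I :: "'k::field xy_poly set" +
  fixes W :: "nat set" and i k :: nat
  assumes W: "W \<subseteq> {1..n}" "i \<in> W" "k \<in> W" "i \<noteq> k"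
    and edge: "minor i k \<in> I"
    and dominating: "\<And>b. b \<in> W \<Longrightarrow> minor i b \<in> I \<or> minor k b \<in> I"
begin

lemma finite_W: "finite W"
  using W(1) finite_subset by auto

lemma var_k_minor_i:
  assumes "b \<in> W" "z = VarX \<or> z = VarY"
  shows "var (z k) * minor i b \<in> I"
  using dominating[OF assms(1)]
proof
  assume "minor i b \<in> I"
  then show ?thesis using assms W by (intro mult xy_ring_var) auto
next
  assume "minor k b \<in> I"
  then show ?thesis using assms W edge by (intro common_neighbour minor_sym[of i k]) auto
qed

lemma var_i_minor_k:
  assumes "b \<in> W" "z = VarX \<or> z = VarY"
  shows "var (z i) * minor k b \<in> I"
  using dominating[OF assms(1)]
proof
  assume "minor k b \<in> I"
  then show ?thesis using assms W by (intro mult xy_ring_var) auto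
next
  assume "minor i b \<in> I"
  then show ?thesis using assms W edge by (intro common_neighbour) auto
qed

text \<open>By the relation between minors, \<open>z\<^sub>i [a, b]\<close> is a combination of \<open>[i, a]\<close> and \<open>[i, b]\<close>, and these are in
  the ideal after multiplication by a variable in column \<open>k\<close>.\<close>

lemma var_i_var_k_minor:
  assumes "a \<in> W" "b \<in> W" "z = VarX \<or> z = VarY" "z' = VarX \<or> z' = VarY"
  shows "var (z' k) * (var (z i) * minor a b) \<in> I"
proof -
  have "var (z' k) * (var (z i) * minor a b)
      = var (z a) * (var (z' k) * minor i b) - var (z b) * (var (z' k) * minor i a)"
    by (subst pluecker[OF assms(3)]) (simp add: algebra_simps)
  also have "\<dots> \<in> I"
    using assms W by (intro diff mult xy_ring_var var_k_minor_i) auto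
  finally show ?thesis .
qed

text \<open>A monomial involving columns \<open>i\<close> and \<open>k\<close> makes all vertices of \<open>W\<close> adjacent. The disjunctions allow
  for the case that a column is supplied by the minor itself.\<close>

lemma monomial_mult_minor:
  assumes ab: "a \<in> W" "b \<in> W" and m: "keys m \<subseteq> xy_vars n"
    and i: "col_deg i m > 0 \<or> i \<in> {a, b}" and k: "col_deg k m > 0 \<or> k \<in> {a, b}"
  shows "single m 1 * minor a b \<in> I"
proof -
  have fst_i: "single m 1 * minor i c \<in> I" if "c \<in> W" "col_deg k m > 0 \<or> k = c" for c
  proof (cases "k = c")
    case True
    then show ?thesis using edge m by (intro mult xy_ring_single) auto
  next
    case False
    then have "col_deg k m > 0" using that by blast
    then obtain z m' where z: "z = VarX \<or> z = VarY" "m = single (z k) 1 + m'" "keys m' \<subseteq> keys m"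
      by (rule extract_column)
    then have "single m 1 * minor i c = single m' (1 :: 'k) * (var (z k) * minor i c)"
      by (simp add: var_def mult_single add_ac flip: mult.assoc)
    then show ?thesis
      using mult[OF xy_ring_single[OF order.trans[OF z(3) m], of 1] var_k_minor_i[OF \<open>c \<in> W\<close> z(1)]]
      by simp
  qed
  have fst_k: "single m 1 * minor k c \<in> I" if "c \<in> W" "col_deg i m > 0 \<or> i = c" for c
  proof (cases "i = c")
    case True
    then show ?thesis using mult[OF xy_ring_single[OF m, of 1] minor_sym[OF edge]] by simp
  next
    case False
    then have "col_deg i m > 0" using that by blast
    then obtain z m' where z: "z = VarX \<or> z = VarY" "m = single (z i) 1 + m'" "keys m' \<subseteq> keys m"
      by (rule extract_column)
    then have "single m 1 * minor k c = single m' (1 :: 'k) * (var (z i) * minor k c)"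
      by (simp add: var_def mult_single add_ac flip: mult.assoc)
    then show ?thesis
      using mult[OF xy_ring_single[OF order.trans[OF z(3) m], of 1] var_i_minor_k[OF \<open>c \<in> W\<close> z(1)]]
      by simp
  qed
  have swap: "single m 1 * minor a b \<in> I" if "single m 1 * minor b a \<in> I"
    using uminus[OF that] by (simp only: minor_swap[of b a] mult_minus_right minus_minus)
  consider "i = a" | "i = b" | "k = a" | "k = b" | "i \<notin> {a, b}" "k \<notin> {a, b}" by blast
  then show ?thesis
  proof cases
    case 1 then show ?thesis using fst_i[of b] ab k W(4) by auto
  next
    case 2 then show ?thesis using fst_i[of a] ab k W(4) swap by auto
  next
    case 3 then show ?thesis using fst_k[of b] ab i W(4) by auto
  next
    case 4 then show ?thesis using fst_k[of a] ab i W(4) swap by auto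
  next
    case 5
    then have "col_deg i m > 0" "col_deg k m > 0" using i k by auto
    then obtain z m' where z: "z = VarX \<or> z = VarY" "m = single (z i) 1 + m'" "keys m' \<subseteq> keys m"
      using extract_column by blast
    then have "col_deg k m' > 0" using \<open>col_deg k m > 0\<close> W(4) by auto
    then obtain z' m'' where z': "z' = VarX \<or> z' = VarY" "m' = single (z' k) 1 + m''"
        "keys m'' \<subseteq> keys m'"
      using extract_column by blast
    have "single m 1 * minor a b = single m'' (1 :: 'k) * (var (z' k) * (var (z i) * minor a b))"
      unfolding z(2) z'(2) by (simp add: var_def mult_single add_ac flip: mult.assoc)
    moreover have "keys m'' \<subseteq> xy_vars n" using z(3) z'(3) m by blast
    ultimately show ?thesis
      using mult[OF xy_ring_single[of m'' n 1] var_i_var_k_minor[OF ab z(1) z'(1)]] by simp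
  qed
qed

text \<open>Monomials of the same class are joined by exchanges \<open>x\<^sub>a y\<^sub>b \<mapsto> x\<^sub>b y\<^sub>a\<close>. As long as the monomials differ
  there is an exchange that brings the \<open>x\<close>-exponents of \<open>m\<close> closer to those of \<open>m'\<close>, and column
  degrees do not change on the way.\<close>

lemma monomials_congruent:
  assumes "keys m \<subseteq> xy_vars n" "toric_class W m = toric_class W m'"
    and "col_deg i m > 0" "col_deg k m > 0"
  shows "single m 1 - single m' 1 \<in> I"
  using assms
proof (induction "\<Sum>w\<in>W. lookup m (VarX w) - lookup m' (VarX w)" arbitrary: m rule: less_induct)
  case less
  have col: "lookup m (VarX w) + lookup m (VarY w) = lookup m' (VarX w) + lookup m' (VarY w)"
    if "w \<in> W" for w
    using fun_cong[OF less.prems(2), of "VarX w"] that by (simp add: toric_class_def col_deg_def)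
  have "(\<Sum>w\<in>W. lookup m (VarY w)) = (\<Sum>w\<in>W. lookup m' (VarY w))"
    using fun_cong[OF less.prems(2), of "VarY i"] W(2) by (simp add: toric_class_def)
  moreover have "(\<Sum>w\<in>W. lookup m (VarX w) + lookup m (VarY w))
      = (\<Sum>w\<in>W. lookup m' (VarX w) + lookup m' (VarY w))"
    by (rule sum.cong) (simp_all add: col)
  ultimately have sumX: "(\<Sum>w\<in>W. lookup m (VarX w)) = (\<Sum>w\<in>W. lookup m' (VarX w))"
    by (simp add: sum.distrib)
  show ?case
  proof (cases "\<exists>a\<in>W. lookup m' (VarX a) < lookup m (VarX a)")
    case False
    then have le: "\<forall>w\<in>W. lookup m (VarX w) \<le> lookup m' (VarX w)" by (simp add: not_less)
    have X: "lookup m (VarX w) = lookup m' (VarX w)" if "w \<in> W" for w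
    proof (rule ccontr)
      assume "lookup m (VarX w) \<noteq> lookup m' (VarX w)"
      then have "(\<Sum>w\<in>W. lookup m (VarX w)) < (\<Sum>w\<in>W. lookup m' (VarX w))"
        using le that by (intro sum_strict_mono_ex1 finite_W) (auto intro!: bexI[of _ w] simp: le_neq_implies_less)
      then show False using sumX by simp
    qed
    have "m = m'"
    proof (rule poly_mapping_eqI)
      fix v show "lookup m v = lookup m' v"
        using fun_cong[OF less.prems(2), of v] X col
        by (cases v) (auto simp: toric_class_def split: if_splits)
    qed
    then show ?thesis by (simp add: zero)
  next
    case True
    then obtain a where a: "a \<in> W" "lookup m' (VarX a) < lookup m (VarX a)" by blast
    \<comment> \<open>The total \<open>x\<close>-degrees agree, so an excess at \<open>a\<close> forces a deficit at some \<open>b\<close>.\<close>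
    have "\<exists>b\<in>W. lookup m (VarX b) < lookup m' (VarX b)"
    proof (rule ccontr)
      assume "\<not> ?thesis"
      then have "(\<Sum>w\<in>W. lookup m' (VarX w)) < (\<Sum>w\<in>W. lookup m (VarX w))"
        using a by (intro sum_strict_mono_ex1 finite_W) (auto simp: not_less)
      then show False using sumX by simp
    qed
    then obtain b where b: "b \<in> W" "lookup m (VarX b) < lookup m' (VarX b)" by blast
    have "a \<noteq> b" using a b by auto
    obtain r where r: "m = single (VarX a) 1 + r" "keys r \<subseteq> keys m"
      using extract_variable[of m "VarX a"] a by auto
    have "lookup r (VarY b) > 0"
      using col[OF b(1)] b(2) arg_cong[OF r(1), of "\<lambda>m. lookup m (VarY b)"]
      by (simp add: lookup_add lookup_single)
    then obtain m0 where m0: "r = single (VarY b) 1 + m0" "keys m0 \<subseteq> keys r"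
      by (rule extract_variable)
    have m: "m = (single (VarX a) 1 + single (VarY b) 1) + m0"
      unfolding r(1) m0(1) by (simp add: ac_simps)
    define m1 where "m1 = (single (VarX b) 1 + single (VarY a) 1) + m0"
    have keys_m0: "keys m0 \<subseteq> xy_vars n" using r m0 less.prems(1) by blast
    have "keys m1 \<subseteq> {VarX b, VarY a} \<union> keys m0"
      unfolding m1_def using keys_add[of "single (VarX b) 1 + single (VarY a) 1" m0]
        keys_add[of "single (VarX b) (1::nat)" "single (VarY a) 1"] by auto
    moreover have "{VarX b, VarY a} \<subseteq> xy_vars n"
      using subsetD[OF W(1) a(1)] subsetD[OF W(1) b(1)] by simp
    ultimately have keys_m1: "keys m1 \<subseteq> xy_vars n" using keys_m0 by blast
    have class_m1: "toric_class W m1 = toric_class W m"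
      using toric_class_swap[OF finite_W a(1) b(1)]
      unfolding m m1_def by (simp add: fun_eq_iff toric_class_add)
    have col_m1: "col_deg w m1 = col_deg w m" for w
      unfolding m m1_def by simp
    have step: "single m 1 - single m1 (1 :: 'k) = single m0 1 * minor a b"
      unfolding m m1_def minor_eq_monomials by (simp add: algebra_simps mult_single)
    have "single m0 1 * minor a b \<in> I"
      using a(1) b(1) keys_m0 less.prems(3,4) unfolding m
      by (intro monomial_mult_minor) (auto split: if_splits)
    moreover have "single m1 1 - single m' 1 \<in> I"
    proof (rule less.hyps)
      have lk: "lookup m1 (VarX w) = (if w = a then lookup m (VarX w) - 1
          else if w = b then lookup m (VarX w) + 1 else lookup m (VarX w))" for w
        using \<open>a \<noteq> b\<close> unfolding m m1_def by (auto simp: lookup_add lookup_single)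
      show "(\<Sum>w\<in>W. lookup m1 (VarX w) - lookup m' (VarX w))
          < (\<Sum>w\<in>W. lookup m (VarX w) - lookup m' (VarX w))"
        using a b by (intro sum_strict_mono_ex1 finite_W) (auto simp: lk intro!: bexI[of _ a])
    qed (use keys_m1 class_m1 less.prems col_m1 in auto)
    ultimately show ?thesis
      using add[of "single m0 1 * minor a b" "single m1 1 - single m' 1"]
      by (simp flip: step)
  qed
qed

text \<open>A monomial of \<open>h\<close> cannot be alone in its class, because the coefficients in a class sum to 0; so it can
  be moved onto another monomial of \<open>h\<close> of that class, modulo the ideal.\<close>

lemma toric_ideal_subset:
  assumes "h \<in> carrier (xy_ring n)" "h \<in> toric_ideal W"
    and "\<And>m. m \<in> keys h \<Longrightarrow> col_deg i m > 0 \<and> col_deg k m > 0"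
  shows "h \<in> I"
  using assms
proof (induction "card (keys h)" arbitrary: h rule: less_induct)
  case less
  show ?case
  proof (cases "h = 0")
    case True
    then show ?thesis by (simp add: zero)
  next
    case False
    then obtain m where m: "m \<in> keys h" by (metis all_not_in_conv keys_eq_empty)
    have "\<exists>m'\<in>keys h. m' \<noteq> m \<and> toric_class W m' = toric_class W m"
    proof (rule ccontr)
      assume neg: "\<not> ?thesis"
      have "class_sum W h (toric_class W m) = (\<Sum>m'\<in>keys h. if m' = m then lookup h m else 0)"
        unfolding class_sum_def by (rule sum.cong) (use neg in \<open>auto simp: when_def\<close>)
      also have "\<dots> = lookup h m" using m by simp
      finally show False using less.prems(2) m by (simp add: toric_ideal_def in_keys_iff)
    qed
    then obtain m' where m': "m' \<in> keys h" "m' \<noteq> m" "toric_class W m' = toric_class W m" by blast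
    define a where "a = lookup h m"
    define h' where "h' = h - single m a + single m' a"
    have sub: "keys h' \<subseteq> keys h - {m}"
      using m' m by (auto simp: h'_def a_def in_keys_iff lookup_add lookup_minus lookup_single when_def
          split: if_splits)
    have "h' \<in> I"
    proof (rule less.hyps)
      show "card (keys h') < card (keys h)"
        using sub m by (intro psubset_card_mono) auto
      show "h' \<in> carrier (xy_ring n)" using sub less.prems(1) by (auto simp: in_xy_ring)
      show "h' \<in> toric_ideal W"
        using less.prems(2) m'(3)
        by (simp add: toric_ideal_def h'_def class_sum_add class_sum_diff class_sum_single)
      show "col_deg i m > 0 \<and> col_deg k m > 0" if "m \<in> keys h'" for m
        using that sub less.prems(3) by blast
    qed
    moreover have "single 0 a * (single m 1 - single m' 1) \<in> I"
      using less.prems m m' by (intro mult xy_ring_single monomials_congruent) (auto simp: in_xy_ring)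
    moreover have "h = h' + single 0 a * (single m 1 - single m' 1)"
      by (simp add: h'_def algebra_simps mult_single)
    ultimately show ?thesis using add by simp
  qed
qed

end

section \<open>Leading monomials and column-homogeneous polynomials\<close>

text \<open>The coefficient of the leading monomial is required to be 1, so that leading monomials multiply over
  any commutative ring.\<close>

definition has_leading_monomial :: "('m \<Rightarrow> nat) \<Rightarrow> ('m \<Rightarrow>\<^sub>0 'a::comm_ring_1) \<Rightarrow> 'm \<Rightarrow> bool" where
  "has_leading_monomial wt g m \<longleftrightarrow> (\<exists>r. g = single m 1 + r \<and> (\<forall>k\<in>keys r. wt k < wt m))"

lemma lookup_leading_monomial:
  assumes "has_leading_monomial wt g m"
  shows "lookup g m = 1"
proof -
  obtain r where r: "g = single m 1 + r" "\<forall>k\<in>keys r. wt k < wt m"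
    using assms unfolding has_leading_monomial_def by blast
  then have "m \<notin> keys r" by blast
  then show ?thesis by (simp add: r(1) lookup_add in_keys_iff)
qed

lemma has_leading_monomial_mult:
  fixes f g :: "('v \<Rightarrow>\<^sub>0 nat) \<Rightarrow>\<^sub>0 'k::comm_ring_1"
  assumes wt: "\<And>m m'. wt (m + m') = wt m + (wt m' :: nat)"
    and "has_leading_monomial wt f m" "has_leading_monomial wt g m'"
  shows "has_leading_monomial wt (f * g) (m + m')"
proof -
  obtain r where r: "f = single m 1 + r" "\<forall>k\<in>keys r. wt k < wt m"
    using assms(2) unfolding has_leading_monomial_def by blast
  obtain s where s: "g = single m' 1 + s" "\<forall>k\<in>keys s. wt k < wt m'"
    using assms(3) unfolding has_leading_monomial_def by blast
  let ?t = "single m 1 * s + (r * single m' 1 + r * s)"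
  have "f * g = single (m + m') 1 + ?t"
    by (simp add: r(1) s(1) algebra_simps mult_single)
  moreover have "wt k < wt (m + m')" if "k \<in> keys ?t" for k
  proof -
    have "k \<in> keys (single m 1 * s) \<or> k \<in> keys (r * single m' 1) \<or> k \<in> keys (r * s)"
      using that keys_add[of "single m 1 * s" "r * single m' 1 + r * s"]
        keys_add[of "r * single m' 1" "r * s"] by blast
    then show ?thesis
    proof (elim disjE)
      assume "k \<in> keys (single m 1 * s)"
      then obtain k1 k2 where "k = k1 + k2" "k1 \<in> keys (single m (1 :: 'k))" "k2 \<in> keys s"
        by (rule keys_mult_exE)
      then show ?thesis using s(2) by (auto simp: wt)
    next
      assume "k \<in> keys (r * single m' 1)"
      then obtain k1 k2 where "k = k1 + k2" "k1 \<in> keys r" "k2 \<in> keys (single m' (1 :: 'k))"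
        by (rule keys_mult_exE)
      then show ?thesis using r(2) by (auto simp: wt)
    next
      assume "k \<in> keys (r * s)"
      then obtain k1 k2 where "k = k1 + k2" "k1 \<in> keys r" "k2 \<in> keys s"
        by (rule keys_mult_exE)
      then show ?thesis using r(2) s(2) by (auto simp: wt intro: add_strict_mono)
    qed
  qed
  ultimately show ?thesis unfolding has_leading_monomial_def by blast
qed

lemma has_leading_monomial_1: "has_leading_monomial wt (1 :: ('v \<Rightarrow>\<^sub>0 nat) \<Rightarrow>\<^sub>0 'k::comm_ring_1) 0"
  unfolding has_leading_monomial_def by (intro exI[of _ 0]) simp

lemma has_leading_monomial_prod:
  fixes f :: "'i \<Rightarrow> ('v \<Rightarrow>\<^sub>0 nat) \<Rightarrow>\<^sub>0 'k::comm_ring_1"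
  assumes wt: "\<And>m m'. wt (m + m') = wt m + (wt m' :: nat)"
    and "\<And>j. j \<in> A \<Longrightarrow> has_leading_monomial wt (f j) (m j)"
  shows "has_leading_monomial wt (\<Prod>j\<in>A. f j) (\<Sum>j\<in>A. m j)"
  using assms(2)
  by (induction A rule: infinite_finite_induct)
    (simp_all add: has_leading_monomial_1 has_leading_monomial_mult[OF wt])

lemma has_leading_monomial_power:
  fixes f :: "('v \<Rightarrow>\<^sub>0 nat) \<Rightarrow>\<^sub>0 'k::comm_ring_1"
  assumes wt: "\<And>m m'. wt (m + m') = wt m + (wt m' :: nat)"
    and "has_leading_monomial wt f m"
  shows "has_leading_monomial wt (f ^ q) (scale q m)"
  by (induction q)
    (simp_all add: has_leading_monomial_1 has_leading_monomial_mult[OF wt assms(2)] scale_Suc)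


definition col_homogeneous :: "nat \<Rightarrow> nat \<Rightarrow> 'k::field xy_poly \<Rightarrow> bool" where
  "col_homogeneous v d g \<longleftrightarrow> (\<forall>m\<in>keys g. col_deg v m = d)"

lemma col_homogeneous_mult:
  assumes "col_homogeneous v d f" "col_homogeneous v e g"
  shows "col_homogeneous v (d + e) (f * g)"
  unfolding col_homogeneous_def
proof
  fix m assume "m \<in> keys (f * g)"
  then obtain m1 m2 where "m = m1 + m2" "m1 \<in> keys f" "m2 \<in> keys g" by (rule keys_mult_exE)
  then show "col_deg v m = d + e" using assms by (simp add: col_homogeneous_def)
qed

lemma col_homogeneous_prod:
  assumes "\<And>j. j \<in> A \<Longrightarrow> col_homogeneous v (d j) (f j)"
  shows "col_homogeneous v (\<Sum>j\<in>A. d j) (\<Prod>j\<in>A. f j)"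
  using assms
  by (induction A rule: infinite_finite_induct)
    (simp_all add: col_homogeneous_mult, simp_all add: col_homogeneous_def)

lemma col_homogeneous_power:
  "col_homogeneous v d f \<Longrightarrow> col_homogeneous v (q * d) (f ^ q)"
  using col_homogeneous_prod[of "{..<q}" v "\<lambda>_. d" "\<lambda>_. f"] by simp

lemma col_homogeneous_diff:
  "col_homogeneous v d f \<Longrightarrow> col_homogeneous v d g \<Longrightarrow> col_homogeneous v d (f - g)"
  unfolding col_homogeneous_def by (auto simp: in_keys_iff lookup_minus)

lemma col_homogeneous_single: "col_deg v m = d \<Longrightarrow> col_homogeneous v d (single m a)"
  by (simp add: col_homogeneous_def)

section \<open>The multiplier\<close>

text \<open>\<open>u j\<close> is the vertex in position \<open>j\<close>.\<close>

locale vertex_enumeration =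
  fixes n :: nat and u :: "nat \<Rightarrow> nat"
  assumes bij: "bij_betw u {1..n} {1..n}"
begin

lemma u_mem: "j \<in> {1..n} \<Longrightarrow> u j \<in> {1..n}"
  using bij_betwE[OF bij] by blast

lemma u_eq_iff: "i \<in> {1..n} \<Longrightarrow> j \<in> {1..n} \<Longrightarrow> u i = u j \<longleftrightarrow> i = j"
  using inj_on_eq_iff[OF bij_betw_imp_inj_on[OF bij]] by blast

text \<open>The monomials \<open>x\<^bsub>u j\<^esub> y\<^bsub>u (j + 1)\<^esub>\<close>, where factors outside the range \<open>1, \<dots>, n\<close> of positions are
  dropped. With this convention \<open>factor 0\<close> is \<open>y\<^bsub>u 1\<^esub>\<close> and \<open>factor n\<close> is \<open>x\<^bsub>u n\<^esub>\<close>, and for \<open>n = 0\<close> the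
  multiplier is 1.\<close>

definition lead :: "nat \<Rightarrow> xy_var \<Rightarrow>\<^sub>0 nat" where
  "lead j = (if j = 0 then 0 else single (VarX (u j)) 1) + (if j = n then 0 else single (VarY (u (Suc j))) 1)"

definition factor :: "nat \<Rightarrow> 'k::field xy_poly" where
  "factor j = single (lead j) 1 -
    (if 0 < j \<and> j < n then single (single (VarX (u (Suc j))) 1 + single (VarY (u j)) 1) 1 else 0)"

definition multiplier :: "'k::field xy_poly" where
  "multiplier = (\<Prod>j\<le>n. factor j)"

definition full_monomial :: "xy_var \<Rightarrow>\<^sub>0 nat" where
  "full_monomial = (\<Sum>j\<le>n. lead j)"

lemma factor_eq_minor: "0 < j \<Longrightarrow> j < n \<Longrightarrow> factor j = minor (u j) (u (Suc j))"
  by (simp add: factor_def lead_def minor_eq_monomials)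

lemma full_monomial_eq:
  "full_monomial = (\<Sum>w\<in>{1..n}. single (VarX w) 1) + (\<Sum>w\<in>{1..n}. single (VarY w) 1)"
proof -
  have "(\<Sum>j\<le>n. if j = 0 then 0 else single (VarX (u j)) 1) = (\<Sum>j\<in>{1..n}. single (VarX (u j)) (1 :: nat))"
    by (rule sum.mono_neutral_cong_right) auto
  also have "\<dots> = (\<Sum>w\<in>{1..n}. single (VarX w) 1)"
    by (rule sum.reindex_bij_betw[OF bij])
  finally have X: "(\<Sum>j\<le>n. if j = 0 then 0 else single (VarX (u j)) 1) = (\<Sum>w\<in>{1..n}. single (VarX w) (1 :: nat))" .
  have "(\<Sum>j\<le>n. if j = n then 0 else single (VarY (u (Suc j))) 1) = (\<Sum>j<n. single (VarY (u (Suc j))) (1 :: nat))"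
    by (rule sum.mono_neutral_cong_right) auto
  also have "\<dots> = (\<Sum>j\<in>{1..n}. single (VarY (u j)) 1)"
    by (rule sum.reindex_bij_witness[of _ "\<lambda>j. j - 1" Suc]) auto
  also have "\<dots> = (\<Sum>w\<in>{1..n}. single (VarY w) 1)"
    by (rule sum.reindex_bij_betw[OF bij])
  finally show ?thesis using X
    unfolding full_monomial_def lead_def by (simp add: sum.distrib)
qed

lemma lookup_full_monomial: "lookup full_monomial v = (if v \<in> xy_vars n then 1 else 0)"
  by (cases v) (simp_all add: full_monomial_eq lookup_add lookup_sum lookup_single when_def)

lemma col_homogeneous_factor:
  assumes "i \<in> {1..n}" "j \<le> n"
  shows "col_homogeneous (u i) ((if j = i then 1 else 0) + (if Suc j = i then 1 else 0)) (factor j)"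
  unfolding factor_def lead_def using assms
  by (intro col_homogeneous_diff col_homogeneous_single)
    (auto simp: u_eq_iff col_homogeneous_def)

text \<open>Exactly the two factors with numbers \<open>i - 1\<close> and \<open>i\<close> involve the column in position \<open>i\<close>.\<close>

lemma col_homogeneous_multiplier:
  assumes "i \<in> {1..n}"
  shows "col_homogeneous (u i) 2 (multiplier :: 'k::field xy_poly)"
proof -
  have "(\<Sum>j\<le>n. (if j = i then 1 else 0) + (if Suc j = i then 1 else 0)) = (2 :: nat)"
  proof -
    have "(\<Sum>j\<le>n. if Suc j = i then 1 else 0) = (\<Sum>j\<le>n. if j = i - 1 then 1 else (0 :: nat))"
      by (rule sum.cong) (use assms in auto)
    moreover have "i - 1 \<le> n" using assms by auto
    ultimately show ?thesis using assms by (simp add: sum.distrib)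
  qed
  moreover have "col_homogeneous (u i) (\<Sum>j\<le>n. (if j = i then 1 else 0) + (if Suc j = i then 1 else 0))
      (\<Prod>j\<le>n. factor j :: 'k xy_poly)"
    by (intro col_homogeneous_prod col_homogeneous_factor assms) simp
  ultimately show ?thesis unfolding multiplier_def by simp
qed

text \<open>Decreasing weights on the \<open>x\<close>-variables make \<open>x\<^bsub>u j\<^esub> y\<^bsub>u (j + 1)\<^esub>\<close> the leading monomial of the \<open>j\<close>-th minor.\<close>

definition weight :: "(xy_var \<Rightarrow>\<^sub>0 nat) \<Rightarrow> nat" where
  "weight m = (\<Sum>j\<in>{1..n}. (n - j) * lookup m (VarX (u j)))"

lemma weight_add: "weight (m + m') = weight m + weight m'"
  by (simp add: weight_def lookup_add distrib_left sum.distrib)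

lemma weight_single:
  "j \<in> {1..n} \<Longrightarrow> weight (single (VarX (u j)) 1) = n - j"
  "weight (single (VarY w) a) = 0"
proof -
  assume j: "j \<in> {1..n}"
  have "weight (single (VarX (u j)) 1) = (\<Sum>i\<in>{1..n}. if i = j then n - i else 0)"
    unfolding weight_def
    by (rule sum.cong) (use j in \<open>auto simp: lookup_single when_def u_eq_iff\<close>)
  then show "weight (single (VarX (u j)) 1) = n - j" using j by simp
qed (simp add: weight_def lookup_single)

lemma has_leading_monomial_factor:
  assumes "j \<le> n"
  shows "has_leading_monomial weight (factor j) (lead j)"
proof (cases "0 < j \<and> j < n")
  case True
  then have "weight (lead j) = n - j"
    and "weight (single (VarX (u (Suc j))) 1 + single (VarY (u j)) 1) = n - Suc j"
    using weight_single(1)[of j] weight_single(1)[of "Suc j"]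
    by (simp_all add: lead_def weight_add weight_single(2))
  moreover have "n - Suc j < n - j" using True by linarith
  ultimately show ?thesis
    using True unfolding has_leading_monomial_def factor_def
    by (intro exI[of _ "- single (single (VarX (u (Suc j))) 1 + single (VarY (u j)) 1) 1"]) simp
next
  case False
  then show ?thesis
    unfolding has_leading_monomial_def factor_def by (intro exI[of _ 0]) auto
qed

lemma lookup_multiplier_power:
  "lookup (multiplier ^ q) (scale q full_monomial) = 1"
  unfolding multiplier_def full_monomial_def
  by (rule lookup_leading_monomial[of weight])
    (intro has_leading_monomial_power has_leading_monomial_prod weight_add
      has_leading_monomial_factor; simp)

lemma multiplier_in_xy_ring: "(multiplier :: 'k::field xy_poly) \<in> carrier (xy_ring n)"
proof -
  have "(factor j :: 'k xy_poly) \<in> carrier (xy_ring n)" if "j \<le> n" for j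
  proof -
    have "keys (lead j) \<subseteq> xy_vars n"
      unfolding lead_def using that u_mem[of j] u_mem[of "Suc j"]
      by (intro order.trans[OF keys_add]) auto
    moreover have "keys (single (VarX (u (Suc j))) (1::nat) + single (VarY (u j)) 1) \<subseteq> xy_vars n"
      if "0 < j" "j < n"
      using that u_mem[of j] u_mem[of "Suc j"] by (intro order.trans[OF keys_add]) auto
    ultimately show ?thesis
      unfolding factor_def by (auto intro!: xy_ring_diff xy_ring_single xy_ring_0)
  qed
  then show ?thesis unfolding multiplier_def by (intro xy_ring_prod) simp
qed

end

section \<open>The splitting\<close>

locale binomial_splitting = vertex_enumeration n u
  for n :: nat and u :: "nat \<Rightarrow> nat" +
  fixes p :: nat and T :: "'k::field itself"
  assumes char: "CHAR('k) = p" and p_pos: "p > 0"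
    and surj: "surj (\<lambda>x :: 'k. x ^ p)"
begin

sublocale frobenius_trace p "scale (p - 1) full_monomial" T
  by unfold_locales (use char p_pos surj in \<open>auto simp: lookup_full_monomial\<close>)

definition splitting :: "'k xy_poly \<Rightarrow> 'k xy_poly" where
  "splitting g = tr (multiplier ^ (p - 1) * g)"

lemma splitting_add: "splitting (f + g) = splitting f + splitting g"
  by (simp only: splitting_def distrib_left tr_add)

lemma splitting_power_mult: "splitting (r ^ p * g) = r * splitting g"
proof -
  have "multiplier ^ (p - 1) * (r ^ p * g) = r ^ p * (multiplier ^ (p - 1) * g)"
    by (simp add: ac_simps)
  then show ?thesis by (simp only: splitting_def tr_power_mult)
qed

lemma splitting_in_xy_ring:
  assumes "g \<in> carrier (xy_ring n)"
  shows "splitting g \<in> carrier (xy_ring n)"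
  unfolding in_xy_ring splitting_def
proof
  fix m assume "m \<in> keys (tr (multiplier ^ (p - 1) * g))"
  then have "scale p m + scale (p - 1) full_monomial \<in> keys (multiplier ^ (p - 1) * g)"
    by (rule keys_tr)
  then have "keys (scale p m + scale (p - 1) full_monomial) \<subseteq> xy_vars n"
    using xy_ring_mult[OF xy_ring_power[OF multiplier_in_xy_ring] assms] unfolding in_xy_ring by blast
  moreover have "keys m \<subseteq> keys (scale p m + scale (p - 1) full_monomial)"
    using p_pos by (auto simp: in_keys_iff lookup_add)
  ultimately show "keys m \<subseteq> xy_vars n" by blast
qed

lemma col_deg_scale: "col_deg v (scale q m) = q * col_deg v m"
  by (simp add: col_deg_def distrib_left)

lemma col_deg_full_monomial: "v \<in> {1..n} \<Longrightarrow> col_deg v full_monomial = 2"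
  by (simp add: col_deg_def lookup_full_monomial)

lemma u_surj:
  assumes "v \<in> {1..n}"
  obtains i where "i \<in> {1..n}" "v = u i"
proof -
  have "v \<in> u ` {1..n}" using assms bij_betw_imp_surj_on[OF bij] by simp
  then show thesis by (elim imageE) (rule that)
qed

text \<open>The degree 2 of the multiplier in each column leaves only the constant monomial in \<open>\<phi> 1\<close>, and its
  coefficient is that of the leading monomial of the power of the multiplier.\<close>

lemma splitting_1: "splitting 1 = 1"
proof (rule poly_mapping_eqI)
  fix m
  show "lookup (splitting 1) m = lookup 1 m"
  proof (cases "m = 0")
    case True
    then show ?thesis
      unfolding splitting_def lookup_tr by (simp add: lookup_multiplier_power)
  next
    case False
    have "m \<notin> keys (splitting 1)"
    proof
      assume m: "m \<in> keys (splitting 1)"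
      then have key: "scale p m + scale (p - 1) full_monomial \<in> keys (multiplier ^ (p - 1) :: 'k xy_poly)"
        using keys_tr[of m "multiplier ^ (p - 1)"] by (simp add: splitting_def)
      have "keys m \<subseteq> xy_vars n"
        using splitting_in_xy_ring[OF xy_ring_1] m unfolding in_xy_ring by blast
      moreover have "col_deg v m = 0" if v: "v \<in> {1..n}" for v
      proof -
        obtain i where i: "i \<in> {1..n}" "v = u i" using v by (rule u_surj)
        have "col_deg v (scale p m + scale (p - 1) full_monomial) = (p - 1) * 2"
          using col_homogeneous_power[OF col_homogeneous_multiplier[OF i(1)], of "p - 1"] key
          unfolding i(2) col_homogeneous_def by blast
        then show ?thesis
          using p_pos v by (simp add: col_deg_scale col_deg_full_monomial)
      qed
      ultimately have "lookup m v = 0" for v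
        by (cases v) (auto simp: col_deg_def in_keys_iff subset_iff)
      then have "m = 0" by (intro poly_mapping_eqI) simp
      then show False using False by blast
    qed
    then show ?thesis using False by (simp add: in_keys_iff lookup_one)
  qed
qed

text \<open>In each of the two columns \<open>F\<^sup>p\<^sup>-\<^sup>1\<close> contributes degree \<open>2 (p - 1)\<close>, which is the shift that
  the trace removes, and the minor contributes one more.\<close>

lemma splitting_minor_col_deg:
  assumes m: "m \<in> keys (splitting (a * minor (u i) (u k)))"
    and "i \<in> {1..n}" "k \<in> {1..n}" "j \<in> {i, k}"
  shows "col_deg (u j) m > 0"
proof -
  have "scale p m + scale (p - 1) full_monomial
      \<in> keys (multiplier ^ (p - 1) * (a * minor (u i) (u k)))"
    using m unfolding splitting_def by (rule keys_tr)
  then obtain m1 m' where m1: "scale p m + scale (p - 1) full_monomial = m1 + m'"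
      "m1 \<in> keys (multiplier ^ (p - 1) :: 'k xy_poly)" "m' \<in> keys (a * minor (u i) (u k))"
    by (rule keys_mult_exE)
  obtain m2 m3 where m2: "m' = m2 + m3" "m2 \<in> keys a" "m3 \<in> keys (minor (u i) (u k) :: 'k xy_poly)"
    using m1(3) by (rule keys_mult_exE)
  have j: "j \<in> {1..n}" using assms by blast
  have "col_deg (u j) m1 = (p - 1) * 2"
    using col_homogeneous_power[OF col_homogeneous_multiplier[OF j], of "p - 1"] m1(2)
    unfolding col_homogeneous_def by blast
  moreover have "m3 = single (VarX (u i)) 1 + single (VarY (u k)) 1
      \<or> m3 = single (VarX (u k)) 1 + single (VarY (u i)) 1"
    using m2(3) unfolding minor_eq_monomials
    by (auto simp: in_keys_iff lookup_minus lookup_single when_def split: if_splits)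
  then have "col_deg (u j) m3 > 0" using assms(4) by auto
  ultimately have "col_deg (u j) (scale p m + scale (p - 1) full_monomial) > (p - 1) * 2"
    unfolding m1(1) m2(1) by simp
  then show ?thesis
    using u_mem[OF j] by (simp add: col_deg_scale col_deg_full_monomial zero_less_mult_iff)
qed

text \<open>The minor divides the multiplier, so \<open>F\<^sup>p\<^sup>-\<^sup>1\<close> times it is divisible by its \<open>p\<close>-th power.\<close>

lemma splitting_adjacent_minor:
  assumes "0 < j" "j < n"
  obtains b where "splitting (a * minor (u j) (u (Suc j))) = minor (u j) (u (Suc j)) * b"
proof
  define rest :: "'k xy_poly" where "rest = (\<Prod>i\<in>{..n} - {j}. factor i)"
  let ?d = "minor (u j) (u (Suc j)) :: 'k xy_poly"
  have "multiplier = ?d * rest"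
    unfolding multiplier_def rest_def factor_eq_minor[OF assms, symmetric]
    by (rule prod.remove) (use assms in auto)
  moreover have "?d ^ p = ?d * ?d ^ (p - 1)"
    using p_pos by (metis Suc_diff_1 power_Suc)
  ultimately have "multiplier ^ (p - 1) * (a * ?d) = ?d ^ p * (rest ^ (p - 1) * a)"
    by (simp add: power_mult_distrib ac_simps)
  then show "splitting (a * ?d) = ?d * tr (rest ^ (p - 1) * a)"
    by (simp only: splitting_def tr_power_mult)
qed

text \<open>Induction on \<open>k\<close>: by semilinearity \<open>x\<^bsub>u k\<^esub> \<phi> (a [u i, u (k + 1)])\<close> is
  \<open>\<phi> (a x\<^bsub>u k\<^esub>\<^sup>p [u i, u (k + 1)])\<close>, and \<open>x\<^bsub>u k\<^esub> [u i, u (k + 1)]\<close> is a combination of \<open>[u i, u k]\<close> and the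
  adjacent minor \<open>[u k, u (k + 1)]\<close>.\<close>

lemma splitting_minor_in_toric_ideal:
  assumes "finite W" "u ` {i..k} \<subseteq> W" "0 < i" "i < k" "k \<le> n"
  shows "splitting (a * minor (u i) (u k)) \<in> toric_ideal W"
  using assms(2,4,5)
proof (induction k arbitrary: a)
  case (Suc k)
  have W: "u i \<in> W" "u k \<in> W" "u (Suc k) \<in> W" using Suc.prems by auto
  have adjacent: "splitting (b * minor (u k) (u (Suc k))) \<in> toric_ideal W" for b
  proof -
    obtain b' where "splitting (b * minor (u k) (u (Suc k))) = minor (u k) (u (Suc k)) * b'"
      by (rule splitting_adjacent_minor[of k b]) (use Suc.prems assms(3) in auto)
    then show ?thesis using minor_mult_in_toric_ideal[OF assms(1) W(2,3)] by simp
  qed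
  show ?case
  proof (cases "i = k")
    case True
    then show ?thesis using adjacent by simp
  next
    case False
    let ?x = "\<lambda>j. var (VarX (u j)) :: 'k xy_poly"
    have pl: "?x k * minor (u i) (u (Suc k)) = ?x (Suc k) * minor (u i) (u k) + ?x i * minor (u k) (u (Suc k))"
      by (simp add: minor_def algebra_simps)
    have pow: "?x k ^ p = ?x k ^ (p - 1) * ?x k"
      using p_pos by (metis Suc_diff_1 power_Suc2)
    have "?x k ^ p * (a * minor (u i) (u (Suc k))) = ?x k ^ (p - 1) * a * (?x k * minor (u i) (u (Suc k)))"
      unfolding pow by (simp only: mult_ac)
    also have "\<dots> = (?x k ^ (p - 1) * a * ?x (Suc k)) * minor (u i) (u k)
        + (?x k ^ (p - 1) * a * ?x i) * minor (u k) (u (Suc k))"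
      unfolding pl by (simp only: distrib_left mult.assoc)
    finally have "?x k ^ p * (a * minor (u i) (u (Suc k)))
        = (?x k ^ (p - 1) * a * ?x (Suc k)) * minor (u i) (u k)
        + (?x k ^ (p - 1) * a * ?x i) * minor (u k) (u (Suc k))" .
    then have "?x k * splitting (a * minor (u i) (u (Suc k)))
        = splitting ((?x k ^ (p - 1) * a * ?x (Suc k)) * minor (u i) (u k))
        + splitting ((?x k ^ (p - 1) * a * ?x i) * minor (u k) (u (Suc k)))"
      by (metis splitting_add splitting_power_mult)
    also have "\<dots> \<in> toric_ideal W"
      using False Suc.prems by (intro toric_ideal_add adjacent Suc.IH) auto
    finally show ?thesis by (rule toric_ideal_cancel_variable)
  qed
qed simp

end

section \<open>Binomial edge ideals\<close>

lemma cring_xy_ring: "cring (xy_ring n :: 'k::field xy_poly ring)"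
proof (rule cringI)
  show "abelian_group (xy_ring n :: 'k xy_poly ring)"
  proof (rule abelian_groupI, goal_cases)
    case (6 x)
    then show ?case by (intro bexI[of _ "- x"]) (simp_all add: xy_ring_uminus)
  qed (simp_all add: xy_ring_add xy_ring_0 ac_simps)
  show "Group.comm_monoid (xy_ring n :: 'k xy_poly ring)"
    by (rule comm_monoidI) (simp_all add: xy_ring_mult xy_ring_1 ac_simps)
qed (simp add: distrib_right)

lemma ideal_iff_xy_ideal:
  fixes I :: "'k::field xy_poly set"
  shows "ideal I (xy_ring n) \<longleftrightarrow> I \<subseteq> carrier (xy_ring n) \<and> xy_ideal n I"
proof (intro iffI conjI)
  assume "ideal I (xy_ring n)"
  then interpret ideal I "xy_ring n" .
  show "I \<subseteq> carrier (xy_ring n)" using a_subset .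
  show "xy_ideal n I"
    using additive_subgroup.a_closed[OF is_additive_subgroup] I_l_closed
      additive_subgroup.zero_closed[OF is_additive_subgroup]
    by unfold_locales simp_all
next
  assume I: "I \<subseteq> carrier (xy_ring n) \<and> xy_ideal n I"
  then interpret xy_ideal n I by blast
  interpret R: cring "xy_ring n :: 'k xy_poly ring" by (rule cring_xy_ring)
  show "ideal I (xy_ring n)"
  proof (rule idealI[OF R.ring_axioms])
    show "subgroup I (add_monoid (xy_ring n))"
    proof (rule R.add.subgroupI)
      fix f assume f: "f \<in> I"
      have "\<ominus>\<^bsub>xy_ring n\<^esub> f = - f"
        using I f by (intro R.minus_equality) (auto simp: xy_ring_uminus)
      then show "\<ominus>\<^bsub>xy_ring n\<^esub> f \<in> I" using uminus[OF f] by simp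
    qed (use I zero add in auto)
  next
    fix f g :: "'k xy_poly" assume "f \<in> I" "g \<in> carrier (xy_ring n)"
    then show "g \<otimes>\<^bsub>xy_ring n\<^esub> f \<in> I" "f \<otimes>\<^bsub>xy_ring n\<^esub> g \<in> I"
      using mult[of g f] by (simp_all add: mult.commute)
  qed
qed

lemma nat_pow_xy_ring: "(f :: 'k::field xy_poly) [^]\<^bsub>xy_ring n\<^esub> (q :: nat) = f ^ q"
proof -
  interpret cring "xy_ring n :: 'k xy_poly ring" by (rule cring_xy_ring)
  show ?thesis by (induction q) simp_all
qed

lemma nat_mult_xy_ring: "[q] \<cdot>\<^bsub>xy_ring n\<^esub> f = of_nat q * (f :: 'k::field xy_poly)"
proof -
  interpret cring "xy_ring n :: 'k xy_poly ring" by (rule cring_xy_ring)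
  show ?thesis by (induction q) (simp_all add: distrib_right)
qed


lemma binomial_edge_ideal_generators:
  assumes "simple_graph n E"
  shows "{var (VarX i) * var (VarY j) - var (VarX j) * var (VarY i) | i j. {i, j} \<in> E \<and> i < j}
    \<subseteq> (carrier (xy_ring n) :: 'k::field xy_poly set)"
proof -
  have "i \<in> {1..n} \<and> j \<in> {1..n}" if "{i, j} \<in> E" for i j
    using assms that unfolding simple_graph_def by (auto simp: doubleton_eq_iff)
  then show ?thesis using xy_ring_minor unfolding minor_def by blast
qed

lemma binomial_edge_ideal_ideal:
  assumes "simple_graph n E"
  shows "ideal (binomial_edge_ideal n E :: 'k::field xy_poly set) (xy_ring n)"
  unfolding binomial_edge_ideal_def
  using cring.axioms(1)[OF cring_xy_ring] binomial_edge_ideal_generators[OF assms]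
  by (rule ring.genideal_ideal)

lemma binomial_edge_ideal_least:
  assumes "simple_graph n E" "xy_ideal n I"
    and "\<And>a b. {a, b} \<in> E \<Longrightarrow> a < b \<Longrightarrow> minor a b \<in> I"
  shows "(binomial_edge_ideal n E :: 'k::field xy_poly set) \<subseteq> I"
proof -
  have "ideal (I \<inter> carrier (xy_ring n)) (xy_ring n)"
    unfolding ideal_iff_xy_ideal using assms(2)
    by (auto simp: xy_ideal_def xy_ring_0 xy_ring_add xy_ring_mult)
  moreover have "{var (VarX i) * var (VarY j) - var (VarX j) * var (VarY i) | i j. {i, j} \<in> E \<and> i < j}
      \<subseteq> I \<inter> carrier (xy_ring n)"
    using assms(3) binomial_edge_ideal_generators[OF assms(1)] unfolding minor_def by blast
  ultimately show ?thesis
    unfolding binomial_edge_ideal_def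
    using ring.genideal_minimal[OF cring.axioms(1)[OF cring_xy_ring]] by blast
qed

lemma minor_in_binomial_edge_ideal:
  assumes "simple_graph n E" "{a, b} \<in> E"
  shows "minor a b \<in> binomial_edge_ideal n E"
proof -
  interpret xy_ideal n "binomial_edge_ideal n E"
    using binomial_edge_ideal_ideal[OF assms(1)] ideal_iff_xy_ideal by blast
  have gen: "minor c d \<in> binomial_edge_ideal n E" if "{c, d} \<in> E" "c < d" for c d
    using ring.genideal_self[OF cring.axioms(1)[OF cring_xy_ring] binomial_edge_ideal_generators[OF assms(1)]] that
    unfolding binomial_edge_ideal_def minor_def by blast
  consider "a < b" | "b < a" | "a = b" by linarith
  then show ?thesis
  proof cases
    case 2
    have "{b, a} \<in> E" using assms(2) by (simp add: insert_commute)
    then show ?thesis using gen[OF _ 2] minor_sym by blast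
  qed (use gen assms(2) zero in auto)
qed

text \<open>Every binomial edge ideal is contained in the toric ideal of all columns.\<close>

lemma one_notin_binomial_edge_ideal:
  assumes "simple_graph n E"
  shows "(1 :: 'k::field xy_poly) \<notin> binomial_edge_ideal n E"
proof
  let ?T = "toric_ideal {1..n} :: 'k xy_poly set"
  have "0 \<in> ?T" by (simp add: toric_ideal_def)
  then have "xy_ideal n {g. \<forall>a. a * g \<in> ?T}"
    by unfold_locales (auto simp: distrib_left toric_ideal_add simp flip: mult.assoc)
  then have "(binomial_edge_ideal n E :: 'k xy_poly set) \<subseteq> {g. \<forall>a. a * g \<in> ?T}"
  proof (rule binomial_edge_ideal_least[OF assms])
    fix a b assume "{a, b} \<in> E"
    then have "a \<in> {1..n}" "b \<in> {1..n}"
      using assms unfolding simple_graph_def by (auto simp: doubleton_eq_iff)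
    then have "x * minor a b \<in> ?T" for x
      using minor_mult_in_toric_ideal[of "{1..n}" a b x] by (simp add: mult.commute)
    then show "minor a b \<in> {g. \<forall>a. a * g \<in> ?T}" by blast
  qed
  moreover assume "(1 :: 'k xy_poly) \<in> binomial_edge_ideal n E"
  ultimately have "1 * 1 \<in> ?T" by blast
  then have "single 0 1 \<in> ?T" by simp
  then show False
    using class_sum_single[of "{1..n}" 0 "1 :: 'k" "toric_class {1..n} 0"]
    by (simp add: toric_ideal_def del: single_one)
qed

section \<open>Compatibility of the splitting for weakly closed graphs\<close>

text \<open>Only here do edges enter: weak closedness makes the ends of the edge dominate the vertices between
  them, so the two properties of \<open>\<phi> (a [u i, u k])\<close> put it into the ideal.\<close>

lemma (in binomial_splitting) splitting_minor_in_binomial_edge_ideal: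
  assumes E: "simple_graph n E"
    and weakly_closed: "\<And>i j k. 0 < i \<Longrightarrow> i < j \<Longrightarrow> j < k \<Longrightarrow> k \<le> n \<Longrightarrow>
      {u i, u k} \<in> E \<Longrightarrow> {u i, u j} \<in> E \<or> {u j, u k} \<in> E"
    and ik: "0 < i" "i < k" "k \<le> n" "{u i, u k} \<in> E" and a: "a \<in> carrier (xy_ring n)"
  shows "splitting (a * minor (u i) (u k)) \<in> binomial_edge_ideal n E"
proof -
  let ?J = "binomial_edge_ideal n E :: 'k xy_poly set"
  let ?W = "u ` {i..k}"
  have J: "xy_ideal n ?J"
    using binomial_edge_ideal_ideal[OF E] ideal_iff_xy_ideal by blast
  note edge = minor_in_binomial_edge_ideal[OF E]
  have ik': "i \<in> {1..n}" "k \<in> {1..n}" using ik by auto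
  interpret dominating_edge n ?J ?W "u i" "u k"
  proof (intro dominating_edge.intro J dominating_edge_axioms.intro)
    show "?W \<subseteq> {1..n}" using ik by (intro image_subsetI u_mem) auto
    show "u i \<noteq> u k" using u_eq_iff[OF ik'] ik by simp
    show "minor (u i) (u k) \<in> ?J" using edge ik(4) .
    fix b assume "b \<in> ?W"
    then obtain j where j: "b = u j" "i \<le> j" "j \<le> k" by auto
    consider "j = i" | "j = k" | "i < j" "j < k" using j by linarith
    then show "minor (u i) b \<in> ?J \<or> minor (u k) b \<in> ?J"
    proof cases
      case 1
      then show ?thesis using xy_ideal.zero[OF J] by (simp add: j(1))
    next
      case 2
      then show ?thesis using xy_ideal.zero[OF J] by (simp add: j(1))
    next
      case 3
      then have "{u i, u j} \<in> E \<or> {u k, u j} \<in> E"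
        using weakly_closed[of i j k] ik by (simp add: insert_commute)
      then show ?thesis using edge j(1) by blast
    qed
  qed (use ik in auto)
  show ?thesis
  proof (rule toric_ideal_subset)
    show "splitting (a * minor (u i) (u k)) \<in> carrier (xy_ring n)"
      by (intro splitting_in_xy_ring xy_ring_mult xy_ring_minor a u_mem ik')
    show "splitting (a * minor (u i) (u k)) \<in> toric_ideal ?W"
      using ik by (intro splitting_minor_in_toric_ideal) auto
    show "0 < col_deg (u i) m \<and> 0 < col_deg (u k) m" if "m \<in> keys (splitting (a * minor (u i) (u k)))" for m
      using splitting_minor_col_deg[OF that ik'] by blast
  qed
qed

lemma weakly_closed_enumeration:
  assumes E: "simple_graph n E" and "weakly_closed n E"
  obtains u where "bij_betw u {1..n} {1..n}"
    and "\<And>i j k. 0 < i \<Longrightarrow> i < j \<Longrightarrow> j < k \<Longrightarrow> k \<le> n \<Longrightarrow>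
      {u i, u k} \<in> E \<Longrightarrow> {u i, u j} \<in> E \<or> {u j, u k} \<in> E"
proof -
  obtain l where l: "bij_betw l {1..n} {1..n}"
    and wc: "\<And>i j k. 1 \<le> i \<Longrightarrow> i < j \<Longrightarrow> j < k \<Longrightarrow> k \<le> n \<Longrightarrow>
      {i, k} \<in> (`) l ` E \<Longrightarrow> {i, j} \<in> (`) l ` E \<or> {j, k} \<in> (`) l ` E"
    using assms(2) unfolding weakly_closed_def by (elim exE conjE) metis
  define u where "u = inv_into {1..n} l"
  have lu: "l (u i) = i" if "i \<in> {1..n}" for i
    using bij_betw_inv_into_right[OF l that] by (simp add: u_def)
  have ul: "u (l i) = i" if "i \<in> {1..n}" for i
    using bij_betw_inv_into_left[OF l that] by (simp add: u_def)
  have edge_iff: "{i, j} \<in> (`) l ` E \<longleftrightarrow> {u i, u j} \<in> E" if ij: "i \<in> {1..n}" "j \<in> {1..n}" for i j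
  proof
    assume "{i, j} \<in> (`) l ` E"
    then obtain e where e: "e \<in> E" "{i, j} = l ` e" by blast
    have "e \<subseteq> {1..n}" using E e(1) unfolding simple_graph_def by blast
    then have "u ` (l ` e) = e" using ul by (force simp: image_image)
    then show "{u i, u j} \<in> E" using e by (metis image_empty image_insert)
  next
    assume "{u i, u j} \<in> E"
    moreover have "l ` {u i, u j} = {i, j}" using lu ij by simp
    ultimately show "{i, j} \<in> (`) l ` E" by (metis image_eqI)
  qed
  show thesis
  proof
    show "bij_betw u {1..n} {1..n}" unfolding u_def by (rule bij_betw_inv_into[OF l])
    fix i j k :: nat assume "0 < i" "i < j" "j < k" "k \<le> n" "{u i, u k} \<in> E"
    then show "{u i, u j} \<in> E \<or> {u j, u k} \<in> E"
      using wc[of i j k] edge_iff[of i k] edge_iff[of i j] edge_iff[of j k] by simp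
  qed
qed

theorem theorem2p3:
  fixes n p :: nat and E :: "nat set set"
  assumes "perfect_field TYPE('k::field)"
    and "CHAR('k) = p" and "p > 0"
    and "simple_graph n E"
    and "weakly_closed n E"
  shows "F_pure TYPE('m) p
    (xy_ring n Quot (binomial_edge_ideal n E :: 'k xy_poly set))"
proof -
  obtain u where bij: "bij_betw u {1..n} {1..n}"
    and wc: "\<And>i j k. 0 < i \<Longrightarrow> i < j \<Longrightarrow> j < k \<Longrightarrow> k \<le> n \<Longrightarrow>
      {u i, u k} \<in> E \<Longrightarrow> {u i, u j} \<in> E \<or> {u j, u k} \<in> E"
    using weakly_closed_enumeration[OF assms(4,5)] by metis
  have surj: "surj (\<lambda>x :: 'k. x ^ p)"
    using assms(1-3) unfolding perfect_field_def by simp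
  interpret binomial_splitting n u p "TYPE('k)"
    by unfold_locales (fact bij assms surj)+
  let ?S = "xy_ring n :: 'k xy_poly ring"
  let ?J = "binomial_edge_ideal n E :: 'k xy_poly set"
  have J: "ideal ?J ?S" by (rule binomial_edge_ideal_ideal[OF assms(4)])
  then interpret J: xy_ideal n ?J using ideal_iff_xy_ideal by blast
  \<comment> \<open>Quantifying over \<open>a\<close> makes the preimage of the ideal under \<open>\<phi>\<close> an ideal, so that generators suffice.\<close>
  let ?I = "{g. \<forall>a\<in>carrier ?S. splitting (a * g) \<in> ?J}"
  have "?J \<subseteq> ?I"
  proof (rule binomial_edge_ideal_least[OF assms(4)])
    show "xy_ideal n ?I"
    proof
      have "splitting 0 = 0" using splitting_add[of 0 0] by simp
      then show "0 \<in> ?I" using J.zero by simp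
      show "f + g \<in> ?I" if "f \<in> ?I" "g \<in> ?I" for f g
        using that by (simp add: distrib_left splitting_add J.add)
      show "g * f \<in> ?I" if "g \<in> carrier ?S" "f \<in> ?I" for f g
        using that xy_ring_mult by (auto simp flip: mult.assoc)
    qed
    fix b c assume bc: "{b, c} \<in> E" "b < c"
    then have "b \<in> {1..n}" "c \<in> {1..n}"
      using assms(4) unfolding simple_graph_def by (auto simp: doubleton_eq_iff)
    then obtain i k where i: "i \<in> {1..n}" "b = u i" and k: "k \<in> {1..n}" "c = u k"
      using u_surj by metis
    have "i \<noteq> k" using bc(2) i k by blast
    then consider "i < k" | "k < i" by linarith
    then show "minor b c \<in> ?I"
    proof cases
      case 1
      then show ?thesis
        using splitting_minor_in_binomial_edge_ideal[OF assms(4) wc _ 1] i k bc(1) by auto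
    next
      case 2
      have "splitting (a * minor b c) \<in> ?J" if a: "a \<in> carrier ?S" for a
      proof -
        have "a * minor b c = - a * minor c b"
          by (subst minor_swap) simp
        then show ?thesis
          using splitting_minor_in_binomial_edge_ideal[OF assms(4) wc _ 2 _ _ xy_ring_uminus[OF a]]
            i k bc(1) by (auto simp: insert_commute)
      qed
      then show ?thesis by blast
    qed
  qed
  then have "splitting (1 * g) \<in> ?J" if "g \<in> ?J" for g
    using that xy_ring_1 by blast
  then have compatible: "splitting g \<in> ?J" if "g \<in> ?J" for g
    using that by simp
  show ?thesis
  proof (rule F_pure_quotient_if_compatible_splitting[where \<phi> = splitting, OF cring_xy_ring J prime_p])
    have "of_nat p = (0 :: 'k xy_poly)"
      using assms(2) by (simp add: of_nat_eq_0_iff_char_dvd CHAR_poly)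
    then show "[p] \<cdot>\<^bsub>?S\<^esub> \<one>\<^bsub>?S\<^esub> = \<zero>\<^bsub>?S\<^esub>" by (simp add: nat_mult_xy_ring)
    show "\<one>\<^bsub>?S\<^esub> \<notin> ?J" using one_notin_binomial_edge_ideal[OF assms(4)] by simp
  qed (simp_all add: nat_pow_xy_ring frob_add_poly splitting_in_xy_ring splitting_add
      splitting_power_mult splitting_1 compatible)
qed

end
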